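(* Let $m,n\ge 0$ be integers with $m+n$ even, let $T$ be an $(m,n)$-tangle, let $D$ be a diagram of $T$, and let $k\in\{1,5,7,11,13,17,19,23\}$. Then the complex number $P(D)_k := P(D)|_{q=e^{k\pi i/12}}$ is a 3-move invariant of $T$. That is, if $D$ and $D'$ are diagrams of $(m,n)$-tangles that are related by a finite sequence of Reidemeister moves R1, R2, R3 and $\pm 3$-moves, then $P(D)_k=P(D')_k$.
   Context: Tangles. An (unoriented) $(m,n)$-tangle is an embedding in $\mathbb{R}^2\times[0,1]$ of $\frac12(m+n)$ arcs and finitely many circles, such that the endpoints of the arcs are distinct points, $m$ of them in one of the planes $\mathbb{R}^2\times\{0\}$, $\mathbb{R}^2\times\{1\}$ and $n$ of them in the other. A diagram $D$ of it is a (generic) projection to $\mathbb{R}\times[0,1]$ with over/under crossing information, the endpoints being mapped to distinct points of the lines $\mathbb{R}\times\{0\}$, $\mathbb{R}\times\{1\}$. 3-moves. A $+3$-move (respectively $-3$-move) is the local change, inside a disk, between two parallel strands and the same two strands twisted around each other by three half-twists (three consecutive crossings) of one handedness (respectively, of the opposite handedness). Skein module. $E_{m,n}$ is the $\mathbb{Z}[q,q^{-1}]$-module generated by planar isotopy classes (rel endpoints) of $(m,n)$-tangle diagrams modulo the local relations $D_{\times}=q\,D_A+q^{-1}D_B$ and $D\cup\bigcirc=\delta D$ with $\delta=-q^2-q^{-2}$. Here $D_\times$ has a crossing, $D_A$ and $D_B$ are its A- and B-smoothings (the A-smoothing joins the two regions swept out by rotating the over-strand counterclockwise until it meets the under-strand;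 the B-smoothing is the other one), and $\bigcirc$ is a crossingless closed loop disjoint from $D$. The class of $D$ is denoted $\langle D\rangle$. $E_{m,n}$ is free, with basis $B_{m,n}=\{e_1,\dots,e_p\}$ the set of flat $(m,n)$-tangle diagrams (crossingless matchings of the $m+n$ endpoints, with no closed loops). Bilinear form. For $(m,n)$-tangle diagrams $T_1,T_2$, $T_1\otimes T_2$ is the $(2m,2n)$-tangle diagram obtained by placing $T_2$ to the right of $T_1$. The plat closure $cl(T_1\otimes T_2)$ is obtained by joining by simple disjoint arcs adjacent upper endpoints (1st with 2nd, 3rd with 4th, and so on, counted from left to right) and likewise adjacent lower endpoints. Let $[\,\cdot\,,\cdot\,]:E_{m,n}\times E_{m,n}\to\mathbb{Z}[q,q^{-1}]$ be the $\mathbb{Z}[q,q^{-1}]$-bilinear form with $[e_i,e_j]=(-q^2-q^{-2})^{\ell}$, where $\ell$ is the number of closed loops in $cl(e_i\otimes e_j)$. Definition of $P$. Let $\overline D$ be the mirror image of $D$ (all crossings switched). Then $P(D):=[\langle D\rangle,\langle\overline D\rangle]\in\mathbb{Z}[q,q^{-1}]$. *)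

theory Defs
  imports Complex_Main "HOL-Library.Poly_Mapping"
begin

section \<open>Laurent polynomials over the integers\<close>

text \<open>
  The ring of integral Laurent polynomials in one variable $q$ is the group ring of the additive
  group of integers: finitely supported functions (exponent to coefficient) with convolution.
\<close>

type_synonym laurent = "int \<Rightarrow>\<^sub>0 int"

definition qpow :: "int \<Rightarrow> laurent" where
  "qpow j = Poly_Mapping.single j 1"

definition loop_value :: laurent where
  "loop_value = - qpow 2 - qpow (-2)"

definition laurent_eval :: "laurent \<Rightarrow> complex \<Rightarrow> complex" where
  "laurent_eval p z = (\<Sum>j\<in>Poly_Mapping.keys p. of_int (Poly_Mapping.lookup p j) * z powi j)"


section \<open>Tangle diagrams\<close>

text \<open>
  A diagram in the strip that is generic with respect to the height function has its minima, maxima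
  and crossings at pairwise distinct heights and is recorded, up to height-preserving planar isotopy,
  by the list of these events read upwards. An event \<open>(s, i)\<close> has exactly \<open>i\<close> strands on its
  left, so it involves the strands in positions \<open>i\<close>, \<open>i + 1\<close>, counted from \<open>0\<close>.
  A \<open>Cup\<close> is a local minimum, a \<open>Cap\<close> a local maximum. In \<open>Cross True\<close> the strand
  going up from left to right is the over-strand, in \<open>Cross False\<close> the one going up from right to
  left.
\<close>

datatype event = Cup | Cap | Cross bool

type_synonym diagram = "(event \<times> nat) list"

fun strands_in :: "event \<Rightarrow> nat" where
  "strands_in Cup = 0"
| "strands_in Cap = 2"
| "strands_in (Cross b) = 2"

fun strands_out :: "event \<Rightarrow> nat" where
  "strands_out Cup = 2"
| "strands_out Cap = 0"
| "strands_out (Cross b) = 2"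

text \<open>Diagrams with \<open>m\<close> lower and \<open>n\<close> upper endpoints.\<close>

fun is_diagram :: "nat \<Rightarrow> nat \<Rightarrow> diagram \<Rightarrow> bool" where
  "is_diagram m n [] \<longleftrightarrow> m = n"
| "is_diagram m n ((s, i) # w) \<longleftrightarrow>
     i + strands_in s \<le> m \<and> is_diagram (m - strands_in s + strands_out s) n w"

definition diagrams :: "nat \<Rightarrow> nat \<Rightarrow> diagram set" where
  "diagrams m n = {w. is_diagram m n w}"

fun mirror_event :: "event \<Rightarrow> event" where
  "mirror_event Cup = Cup"
| "mirror_event Cap = Cap"
| "mirror_event (Cross b) = Cross (\<not> b)"

definition mirror :: "diagram \<Rightarrow> diagram" where
  "mirror w = map (\<lambda>(s, i). (mirror_event s, i)) w"


section \<open>Planar isotopy, Reidemeister moves and 3-moves\<close>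

text \<open>
  In a generic planar isotopy rel endpoints the list of events changes only when two events exchange
  heights (\<open>exchange\<close>), a maximum and a minimum cancel or are born (\<open>zigzag\<close>), or one of the two
  strands of a crossing becomes horizontal at the crossing, so that the crossing moves from one leg of
  a maximum or minimum to the other (\<open>slide\<close>).
\<close>

inductive isotopy_move :: "diagram \<Rightarrow> diagram \<Rightarrow> bool" where
  exchange: "isotopy_move [(s, i), (t, i + strands_out s + d)] [(t, i + strands_in s + d), (s, i)]"
| zigzag_left: "isotopy_move [(Cup, i), (Cap, i + 1)] []"
| zigzag_right: "isotopy_move [(Cup, i + 1), (Cap, i)] []"
| slide_cap: "isotopy_move [(Cross b, i), (Cap, i + 1)] [(Cross (\<not> b), i + 1), (Cap, i)]"
| slide_cup: "isotopy_move [(Cup, i + 1), (Cross b, i)] [(Cup, i), (Cross (\<not> b), i + 1)]"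

text \<open>
  Every other position of the disk in which a move takes place is obtained from those below by planar
  isotopy. In \<open>R3\<close> the side condition excludes exactly the two cyclic patterns, in which
  no strand is on top.
\<close>

inductive reidemeister_move :: "diagram \<Rightarrow> diagram \<Rightarrow> bool" where
  R1_left: "reidemeister_move [(Cup, i), (Cross b, i + 1), (Cap, i)] []"
| R1_right: "reidemeister_move [(Cup, i + 1), (Cross b, i), (Cap, i + 1)] []"
| R2: "reidemeister_move [(Cross b, i), (Cross (\<not> b), i)] []"
| R3: "a = b \<or> b = c \<Longrightarrow>
    reidemeister_move [(Cross a, i), (Cross b, i + 1), (Cross c, i)]
                      [(Cross c, i + 1), (Cross b, i), (Cross a, i + 1)]"

inductive three_move :: "diagram \<Rightarrow> diagram \<Rightarrow> bool" where
  three_move: "three_move [] [(Cross b, i), (Cross b, i), (Cross b, i)]"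

definition locally_related ::
    "(diagram \<Rightarrow> diagram \<Rightarrow> bool) \<Rightarrow> nat \<Rightarrow> nat \<Rightarrow> diagram \<Rightarrow> diagram \<Rightarrow> bool" where
  "locally_related L m n w w' \<longleftrightarrow> w \<in> diagrams m n \<and> w' \<in> diagrams m n \<and>
     (\<exists>u v a b. L a b \<and> w = u @ a @ v \<and> w' = u @ b @ v)"

definition isotopy :: "nat \<Rightarrow> nat \<Rightarrow> (diagram \<times> diagram) set" where
  "isotopy m n = {(w, w'). w \<in> diagrams m n \<and> equivclp (locally_related isotopy_move m n) w w'}"

definition three_move_equivalent :: "nat \<Rightarrow> nat \<Rightarrow> diagram \<Rightarrow> diagram \<Rightarrow> bool" where
  "three_move_equivalent m n =
     equivclp (locally_related (sup isotopy_move (sup reidemeister_move three_move)) m n)"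


section \<open>Closed loops\<close>

text \<open>
  The strands of a diagram are cut at the levels between consecutive events. Level \<open>t\<close> lies
  between the first \<open>t\<close> events and the remaining ones, and \<open>(t, p)\<close> is the point of the diagram
  in position \<open>p\<close> on that level. Two points are adjacent if an arc between two
  consecutive levels joins them.
\<close>

definition width :: "nat \<Rightarrow> diagram \<Rightarrow> nat \<Rightarrow> nat" where
  "width m w t = fold (\<lambda>(s, i) k. k - strands_in s + strands_out s) (take t w) m"

definition points :: "nat \<Rightarrow> diagram \<Rightarrow> (nat \<times> nat) set" where
  "points m w = {(t, p). t \<le> length w \<and> p < width m w t}"

inductive adjacent :: "nat \<Rightarrow> diagram \<Rightarrow> nat \<times> nat \<Rightarrow> nat \<times> nat \<Rightarrow> bool" for m w where
  left_of_event: "t < length w \<Longrightarrow> w ! t = (s, i) \<Longrightarrow> p < i \<Longrightarrow> adjacent m w (t, p) (Suc t, p)"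
| right_of_event: "t < length w \<Longrightarrow> w ! t = (s, i) \<Longrightarrow> i + strands_in s + d < width m w t \<Longrightarrow>
    adjacent m w (t, i + strands_in s + d) (Suc t, i + strands_out s + d)"
| cup: "t < length w \<Longrightarrow> w ! t = (Cup, i) \<Longrightarrow> adjacent m w (Suc t, i) (Suc t, i + 1)"
| cap: "t < length w \<Longrightarrow> w ! t = (Cap, i) \<Longrightarrow> adjacent m w (t, i) (t, i + 1)"
| cross_right: "t < length w \<Longrightarrow> w ! t = (Cross b, i) \<Longrightarrow> adjacent m w (t, i) (Suc t, i + 1)"
| cross_left: "t < length w \<Longrightarrow> w ! t = (Cross b, i) \<Longrightarrow> adjacent m w (t, i + 1) (Suc t, i)"

definition components :: "nat \<Rightarrow> diagram \<Rightarrow> (nat \<times> nat) set set" where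
  "components m w =
     points m w // {(x, y). x \<in> points m w \<and> y \<in> points m w \<and> equivclp (adjacent m w) x y}"

definition closed_loops :: "nat \<Rightarrow> diagram \<Rightarrow> nat" where
  "closed_loops m w = card {C \<in> components m w. \<forall>(t, p) \<in> C. t \<noteq> 0 \<and> t \<noteq> length w}"

definition flat_diagrams :: "nat \<Rightarrow> nat \<Rightarrow> diagram set" where
  "flat_diagrams m n =
     {w \<in> diagrams m n. (\<forall>(s, i) \<in> set w. \<forall>b. s \<noteq> Cross b) \<and> closed_loops m w = 0}"


section \<open>Juxtaposition and plat closure\<close>

text \<open>
  In the juxtaposition of two diagrams with \<open>n\<close> upper endpoints, the events of the left one are put
  below those of the right one, up to planar isotopy.
\<close>

definition juxtapose :: "nat \<Rightarrow> diagram \<Rightarrow> diagram \<Rightarrow> diagram" where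
  "juxtapose n w1 w2 = w1 @ map (\<lambda>(s, i). (s, i + n)) w2"

text \<open>
  Plat closure of a diagram with \<open>2 * m\<close> lower and \<open>2 * n\<close> upper endpoints. After a cap has
  joined the two leftmost upper endpoints, the next pair is again in positions \<open>0\<close>, \<open>1\<close>.
\<close>

definition plat_closure :: "nat \<Rightarrow> nat \<Rightarrow> diagram \<Rightarrow> diagram" where
  "plat_closure m n w = map (\<lambda>j. (Cup, 2 * j)) [0..<m] @ w @ replicate n (Cap, 0)"


section \<open>The skein module\<close>

type_synonym chain = "diagram set \<Rightarrow>\<^sub>0 laurent"

definition scale :: "laurent \<Rightarrow> chain \<Rightarrow> chain" where
  "scale c x = Poly_Mapping.map ((*) c) x"

lemma lookup_scale: "Poly_Mapping.lookup (scale c x) D = c * Poly_Mapping.lookup x D"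
  by (simp add: scale_def Poly_Mapping.map.rep_eq when_def)

global_interpretation skein: module scale
  defines skein_span = skein.span
  by standard
     (auto intro!: poly_mapping_eqI simp: lookup_scale lookup_add algebra_simps)

text \<open>The free module on the planar isotopy classes of diagrams.\<close>

definition free_module :: "nat \<Rightarrow> nat \<Rightarrow> chain set" where
  "free_module m n = {x. Poly_Mapping.keys x \<subseteq> diagrams m n // isotopy m n}"

definition generator :: "nat \<Rightarrow> nat \<Rightarrow> diagram \<Rightarrow> chain" where
  "generator m n w = Poly_Mapping.single (isotopy m n `` {w}) 1"

text \<open>
  Rotating the over-strand of \<open>Cross True\<close> counterclockwise to the under-strand sweeps out the
  regions above and below the crossing. Joining them leaves two vertical strands.
\<close>

fun smoothing_A :: "bool \<Rightarrow> nat \<Rightarrow> diagram" where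
  "smoothing_A True i = []"
| "smoothing_A False i = [(Cap, i), (Cup, i)]"

fun smoothing_B :: "bool \<Rightarrow> nat \<Rightarrow> diagram" where
  "smoothing_B True i = [(Cap, i), (Cup, i)]"
| "smoothing_B False i = []"

inductive_set skein_relations :: "nat \<Rightarrow> nat \<Rightarrow> chain set" for m n where
  crossing: "u @ [(Cross b, i)] @ v \<in> diagrams m n \<Longrightarrow>
    generator m n (u @ [(Cross b, i)] @ v)
      - (scale (qpow 1) (generator m n (u @ smoothing_A b i @ v))
         + scale (qpow (-1)) (generator m n (u @ smoothing_B b i @ v)))
    \<in> skein_relations m n"
| loop: "u @ [(Cup, i), (Cap, i)] @ v \<in> diagrams m n \<Longrightarrow>
    generator m n (u @ [(Cup, i), (Cap, i)] @ v) - scale loop_value (generator m n (u @ v))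
    \<in> skein_relations m n"

text \<open>
  Elements of the skein module are cosets of the submodule spanned by the relations; the coset of
  \<open>x \<in> free_module m n\<close> is \<open>skein_class m n x\<close>.
\<close>

definition skein_class :: "nat \<Rightarrow> nat \<Rightarrow> chain \<Rightarrow> chain set" where
  "skein_class m n x = {y \<in> free_module m n. y - x \<in> skein_span (skein_relations m n)}"

definition diagram_class :: "nat \<Rightarrow> nat \<Rightarrow> diagram \<Rightarrow> chain set" where
  "diagram_class m n w = skein_class m n (generator m n w)"


section \<open>The bilinear form and the polynomial $P$\<close>

definition bilinear_on_skein :: "nat \<Rightarrow> nat \<Rightarrow> (chain set \<Rightarrow> chain set \<Rightarrow> laurent) \<Rightarrow> bool" where
  "bilinear_on_skein m n \<beta> \<longleftrightarrow>
     (\<forall>x \<in> free_module m n. \<forall>y \<in> free_module m n. \<forall>z \<in> free_module m n. \<forall>c.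
        \<beta> (skein_class m n (x + y)) (skein_class m n z)
          = \<beta> (skein_class m n x) (skein_class m n z) + \<beta> (skein_class m n y) (skein_class m n z) \<and>
        \<beta> (skein_class m n (scale c x)) (skein_class m n z)
          = c * \<beta> (skein_class m n x) (skein_class m n z) \<and>
        \<beta> (skein_class m n z) (skein_class m n (x + y))
          = \<beta> (skein_class m n z) (skein_class m n x) + \<beta> (skein_class m n z) (skein_class m n y) \<and>
        \<beta> (skein_class m n z) (skein_class m n (scale c x))
          = c * \<beta> (skein_class m n z) (skein_class m n x))"

definition is_skein_form :: "nat \<Rightarrow> nat \<Rightarrow> (chain set \<Rightarrow> chain set \<Rightarrow> laurent) \<Rightarrow> bool" where
  "is_skein_form m n \<beta> \<longleftrightarrow> bilinear_on_skein m n \<beta> \<and>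
     (\<forall>e \<in> flat_diagrams m n. \<forall>f \<in> flat_diagrams m n.
        \<beta> (diagram_class m n e) (diagram_class m n f)
          = loop_value ^ closed_loops 0 (plat_closure m n (juxtapose n e f)))"

text \<open>
  The classes of the flat diagrams form a basis, so that the form is unique on classes; its values on
  other sets of chains are irrelevant.
\<close>

definition skein_form :: "nat \<Rightarrow> nat \<Rightarrow> chain set \<Rightarrow> chain set \<Rightarrow> laurent" where
  "skein_form m n = (SOME \<beta>. is_skein_form m n \<beta>)"

definition P :: "nat \<Rightarrow> nat \<Rightarrow> diagram \<Rightarrow> laurent" where
  "P m n D = skein_form m n (diagram_class m n D) (diagram_class m n (mirror D))"

end

theory Submission
  imports Defs
begin

text \<open>
  The Kauffman bracket is evaluated by a vertex model: strands are labelled by booleans, cups and caps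
  are two inverse $2\times 2$ matrices with trace pairing $\delta$, and a crossing is
  $q \cdot 1 + q^{-1} \cdot (\mbox{cap then cup})$. Every planar isotopy, R2 and R3 is then an identity
  of operators, R1 multiplies by $-q^{\pm 3}$, and a triple crossing equals
  $q^{\pm 3} + c \cdot (\mbox{cap then cup})$ with
  $c$ a unit times $q^8 - q^4 + 1$, the 24th cyclotomic polynomial. At the given roots of unity
  every move therefore multiplies $D$ by a unit and its mirror image by the inverse unit.

  It remains to see that the form of the skein module is the vertex model of the plat closure.
  Any skein form is determined by its values on words of caps followed by cups, because a
  cup directly below a cap is a circle, a zigzag or can be exchanged with it. For closed crossingless
  diagrams the same reduction shows that the model is $\delta^\ell$; that $\ell$ is the number
  of loops follows from the same model with identity matrices, which counts the $2^\ell$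
  two-colourings of the components.
\<close>

section \<open>Vertex models\<close>

text \<open>
  A labelling of the strands at a level is an infinite sequence, of which a diagram only touches an
  initial segment. Operators then need no information on the number of strands, and the local moves
  become identities without side conditions.
\<close>

definition insert_pair :: "nat \<Rightarrow> bool \<Rightarrow> bool \<Rightarrow> (nat \<Rightarrow> bool) \<Rightarrow> nat \<Rightarrow> bool" where
  "insert_pair i a b s p = (if p < i then s p else if p = i then a else if p = Suc i then b else s (p - 2))"

definition remove_pair :: "nat \<Rightarrow> (nat \<Rightarrow> bool) \<Rightarrow> nat \<Rightarrow> bool" where
  "remove_pair i s p = (if p < i then s p else s (p + 2))"

lemma remove_pair_insert_pair_simps:
  "remove_pair i (insert_pair i a b s) = s"
  "remove_pair (Suc i) (insert_pair i a b s) = s(i := a)"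
  "remove_pair i (insert_pair (Suc i) a b s) = s(i := b)"
  "insert_pair i a b s i = a"
  "insert_pair i a b s (Suc i) = b"
  "insert_pair i a b s (Suc (Suc i)) = s i"
  "insert_pair (Suc i) a b s i = s i"
  by (auto simp: insert_pair_def remove_pair_def fun_eq_iff)

lemma insert_pair_far:
  "insert_pair (i + 2 + d) a b (insert_pair i a' b' s) = insert_pair i a' b' (insert_pair (i + d) a b s)"
  by (auto simp: insert_pair_def fun_eq_iff)

lemma remove_pair_far:
  "remove_pair i (remove_pair (i + 2 + d) s) = remove_pair (i + d) (remove_pair i s)"
  by (auto simp: remove_pair_def fun_eq_iff)

lemma remove_insert_pair_far:
  "remove_pair (i + 2 + d) (insert_pair i a b s) = insert_pair i a b (remove_pair (i + d) s)"
  "remove_pair i (insert_pair (i + 2 + d) a b s) = insert_pair (i + d) a b (remove_pair i s)"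
  \<comment> \<open>What remains are implications between values of \<open>s\<close> at two
    expressions for the same index; \<open>back_subst\<close> reduces them to the equality of the
    indices.\<close>
  by (auto simp: insert_pair_def remove_pair_def fun_eq_iff elim!: back_subst[where P = s])

lemma pair_entries_far:
  "insert_pair i a b s (i + 2 + d) = s (i + d)"
  "insert_pair i a b s (Suc (i + 2 + d)) = s (Suc (i + d))"
  "insert_pair (i + 2 + d) a b s i = s i"
  "insert_pair (i + 2 + d) a b s (Suc i) = s (Suc i)"
  "remove_pair i s (i + d) = s (i + 2 + d)"
  "remove_pair i s (Suc (i + d)) = s (Suc (i + 2 + d))"
  "remove_pair (i + 2 + d) s i = s i"
  "remove_pair (i + 2 + d) s (Suc i) = s (Suc i)"
  by (auto simp: insert_pair_def remove_pair_def)

section \<open>Shifted and mirrored words\<close>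

definition shift :: "nat \<Rightarrow> diagram \<Rightarrow> diagram" where
  "shift n w = map (\<lambda>(s, i). (s, i + n)) w"

lemma shift_simps [simp]:
  "shift n [] = []"
  "shift n ((s, i) # w) = (s, i + n) # shift n w"
  "shift n (u @ v) = shift n u @ shift n v"
  by (auto simp: shift_def)

lemma mirror_simps [simp]:
  "mirror [] = []"
  "mirror ((s, i) # w) = (mirror_event s, i) # mirror w"
  "mirror (u @ v) = mirror u @ mirror v"
  by (auto simp: mirror_def)

lemma strands_mirror_event [simp]:
  "strands_in (mirror_event s) = strands_in s"
  "strands_out (mirror_event s) = strands_out s"
  by (cases s; simp)+

lemma isotopy_move_shift:
  assumes "isotopy_move a b" shows "isotopy_move (shift n a) (shift n b)"
  using assms
proof cases
  case (exchange s i t d)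
  then show ?thesis
    using isotopy_move.exchange[of s "i + n" t d] by (simp add: ac_simps)
next
  case (zigzag_left i)
  then show ?thesis using isotopy_move.zigzag_left[of "i + n"] by simp
next
  case (zigzag_right i)
  then show ?thesis using isotopy_move.zigzag_right[of "i + n"] by simp
next
  case (slide_cap b i)
  then show ?thesis using isotopy_move.slide_cap[of b "i + n"] by simp
next
  case (slide_cup i b)
  then show ?thesis using isotopy_move.slide_cup[of "i + n" b] by simp
qed

lemma isotopy_move_mirror:
  assumes "isotopy_move a b" shows "isotopy_move (mirror a) (mirror b)"
  using assms
proof cases
  case (exchange s i t d)
  then show ?thesis
    using isotopy_move.exchange[of "mirror_event s" i "mirror_event t" d] by simp
next
  case (zigzag_left i)
  then show ?thesis using isotopy_move.zigzag_left[of i] by simp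
next
  case (zigzag_right i)
  then show ?thesis using isotopy_move.zigzag_right[of i] by simp
next
  case (slide_cap b i)
  then show ?thesis using isotopy_move.slide_cap[of "\<not> b" i] by simp
next
  case (slide_cup i b)
  then show ?thesis using isotopy_move.slide_cup[of i "\<not> b"] by simp
qed

text \<open>The two matrix equations are the two zigzags and \<open>circle\<close> is a closed loop.
  The crossing weights stay free, so that one locale serves both for the Kauffman bracket and for
  counting colourings.\<close>

locale tensor_model =
  fixes cup cap :: "bool \<Rightarrow> bool \<Rightarrow> 'r::comm_ring_1" and q q' \<delta> :: 'r
  assumes cup_cap: "(\<Sum>b\<in>UNIV. cup a b * cap b c) = of_bool (a = c)"
    and cap_cup: "(\<Sum>b\<in>UNIV. cap a b * cup b c) = of_bool (a = c)"
    and circle: "(\<Sum>a\<in>UNIV. \<Sum>b\<in>UNIV. cup a b * cap a b) = \<delta>"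
begin

text \<open>Operators pull back: a function of the labels above an event becomes a function of the
  labels below it, and a cup sums over its two new labels. Hence \<open>ev\<close> folds a word from
  its top, and its argument is a function on the top level.\<close>

definition cup_op :: "nat \<Rightarrow> ((nat \<Rightarrow> bool) \<Rightarrow> 'r) \<Rightarrow> (nat \<Rightarrow> bool) \<Rightarrow> 'r" where
  "cup_op i \<phi> s = (\<Sum>a\<in>UNIV. \<Sum>b\<in>UNIV. cup a b * \<phi> (insert_pair i a b s))"

definition cap_op :: "nat \<Rightarrow> ((nat \<Rightarrow> bool) \<Rightarrow> 'r) \<Rightarrow> (nat \<Rightarrow> bool) \<Rightarrow> 'r" where
  "cap_op i \<phi> s = cap (s i) (s (Suc i)) * \<phi> (remove_pair i s)"

text \<open>\<open>weight b\<close> belongs to the smoothing of \<open>Cross b\<close> into two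
  vertical strands, which is the A-smoothing for \<open>True\<close> and the B-smoothing for
  \<open>False\<close>.\<close>

fun weight :: "bool \<Rightarrow> 'r" where
  "weight True = q"
| "weight False = q'"

fun act :: "event \<times> nat \<Rightarrow> ((nat \<Rightarrow> bool) \<Rightarrow> 'r) \<Rightarrow> (nat \<Rightarrow> bool) \<Rightarrow> 'r" where
  "act (Cup, i) = cup_op i"
| "act (Cap, i) = cap_op i"
| "act (Cross b, i) = (\<lambda>\<phi> s. weight b * \<phi> s + weight (\<not> b) * cap_op i (cup_op i \<phi>) s)"

definition ev :: "diagram \<Rightarrow> ((nat \<Rightarrow> bool) \<Rightarrow> 'r) \<Rightarrow> (nat \<Rightarrow> bool) \<Rightarrow> 'r" where
  "ev w \<phi> = foldr act w \<phi>"

lemma ev_simps [simp]: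
  "ev [] \<phi> = \<phi>"
  "ev (x # w) \<phi> = act x (ev w \<phi>)"
  "ev (u @ v) \<phi> = ev u (ev v \<phi>)"
  by (simp_all add: ev_def)

lemma cup_op_linear:
  "cup_op i (\<lambda>s. \<phi> s + \<psi> s) = (\<lambda>s. cup_op i \<phi> s + cup_op i \<psi> s)"
  "cup_op i (\<lambda>s. \<phi> s - \<psi> s) = (\<lambda>s. cup_op i \<phi> s - cup_op i \<psi> s)"
  "cup_op i (\<lambda>s. - \<phi> s) = (\<lambda>s. - cup_op i \<phi> s)"
  "cup_op i (\<lambda>s. c * \<phi> s) = (\<lambda>s. c * cup_op i \<phi> s)"
  by (simp_all add: cup_op_def fun_eq_iff UNIV_bool algebra_simps)

lemma cap_op_linear:
  "cap_op i (\<lambda>s. \<phi> s + \<psi> s) = (\<lambda>s. cap_op i \<phi> s + cap_op i \<psi> s)"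
  "cap_op i (\<lambda>s. \<phi> s - \<psi> s) = (\<lambda>s. cap_op i \<phi> s - cap_op i \<psi> s)"
  "cap_op i (\<lambda>s. - \<phi> s) = (\<lambda>s. - cap_op i \<phi> s)"
  "cap_op i (\<lambda>s. c * \<phi> s) = (\<lambda>s. c * cap_op i \<phi> s)"
  by (simp_all add: cap_op_def fun_eq_iff algebra_simps)

lemma act_linear:
  "act x (\<lambda>s. \<phi> s + \<psi> s) = (\<lambda>s. act x \<phi> s + act x \<psi> s)"
  "act x (\<lambda>s. c * \<phi> s) = (\<lambda>s. c * act x \<phi> s)"
  by (cases x rule: act.cases; simp add: cup_op_linear cap_op_linear algebra_simps)+

lemma ev_linear:
  "ev w (\<lambda>s. \<phi> s + \<psi> s) = (\<lambda>s. ev w \<phi> s + ev w \<psi> s)"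
  "ev w (\<lambda>s. c * \<phi> s) = (\<lambda>s. c * ev w \<phi> s)"
  by (induction w) (simp_all add: act_linear)

lemma zigzag_ops [simp]:
  "cup_op i (cap_op (Suc i) \<phi>) = \<phi>"
  "cup_op (Suc i) (cap_op i \<phi>) = \<phi>"
proof -
  show "cup_op i (cap_op (Suc i) \<phi>) = \<phi>"
  proof
    fix s
    \<comment> \<open>After regrouping, the inner sum is an entry of a matrix product, so a
      Kronecker delta that forces the label \<open>a\<close> back to \<open>s i\<close>.\<close>
    have "cup_op i (cap_op (Suc i) \<phi>) s
        = (\<Sum>a\<in>UNIV. (\<Sum>b\<in>UNIV. cup a b * cap b (s i)) * \<phi> (s(i := a)))"
      by (simp add: cup_op_def cap_op_def remove_pair_insert_pair_simps UNIV_bool algebra_simps)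
    then show "cup_op i (cap_op (Suc i) \<phi>) s = \<phi> s"
      unfolding cup_cap by (cases "s i") (auto simp: UNIV_bool fun_upd_idem)
  qed
  show "cup_op (Suc i) (cap_op i \<phi>) = \<phi>"
  proof
    fix s
    have "cup_op (Suc i) (cap_op i \<phi>) s
        = (\<Sum>b\<in>UNIV. (\<Sum>a\<in>UNIV. cap (s i) a * cup a b) * \<phi> (s(i := b)))"
      by (simp add: cup_op_def cap_op_def remove_pair_insert_pair_simps UNIV_bool algebra_simps)
    then show "cup_op (Suc i) (cap_op i \<phi>) s = \<phi> s"
      unfolding cap_cup by (cases "s i") (auto simp: UNIV_bool fun_upd_idem)
  qed
qed

lemma circle_ops [simp]: "cup_op i (cap_op i \<phi>) = (\<lambda>s. \<delta> * \<phi> s)"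
proof
  fix s
  have "cup_op i (cap_op i \<phi>) s = (\<Sum>a\<in>UNIV. \<Sum>b\<in>UNIV. cup a b * cap a b) * \<phi> s"
    by (simp add: cup_op_def cap_op_def remove_pair_insert_pair_simps UNIV_bool algebra_simps)
  then show "cup_op i (cap_op i \<phi>) s = \<delta> * \<phi> s"
    unfolding circle .
qed

lemma exchange_ops:
  "cup_op i (cup_op (i + 2 + d) \<phi>) = cup_op (i + d) (cup_op i \<phi>)"
  "cup_op i (cap_op (i + 2 + d) \<phi>) = cap_op (i + d) (cup_op i \<phi>)"
  "cap_op i (cup_op (i + d) \<phi>) = cup_op (i + 2 + d) (cap_op i \<phi>)"
  "cap_op i (cap_op (i + d) \<phi>) = cap_op (i + 2 + d) (cap_op i \<phi>)"
  unfolding cup_op_def cap_op_def fun_eq_iff insert_pair_far remove_pair_far remove_insert_pair_far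
    pair_entries_far
  by (simp_all add: UNIV_bool algebra_simps)

text \<open>A crossing is a combination of the identity and a cap followed by a cup, so by linearity
  it commutes with distant events because cups and caps do. \<open>simp only\<close> keeps positions
  in the shape \<open>i + 2 + d\<close>.\<close>

lemma exchange_cup_cap:
  "cup_op i (act (t, i + 2 + d) \<phi>) = act (t, i + d) (cup_op i \<phi>)"
  "cap_op i (act (t, i + d) \<phi>) = act (t, i + 2 + d) (cap_op i \<phi>)"
  by (cases t; simp only: act.simps cup_op_linear cap_op_linear exchange_ops)+

lemma ev_isotopy_move:
  assumes "isotopy_move a b" shows "ev a \<phi> = ev b \<phi>"
  using assms
proof cases
  case (exchange s i t d)
  have "act (s, i) (act (t, i + strands_out s + d) \<phi>) = act (t, i + strands_in s + d) (act (s, i) \<phi>)"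
  proof (cases s)
    case Cup
    then show ?thesis using exchange_cup_cap(1) by simp
  next
    case Cap
    then show ?thesis using exchange_cup_cap(2) by simp
  next
    case (Cross b)
    \<comment> \<open>Moving down past the cup lowers the position of the distant event by 2; moving
      past the cap raises it again.\<close>
    have "cap_op i (cup_op i (act (t, i + 2 + d) \<phi>)) = act (t, i + 2 + d) (cap_op i (cup_op i \<phi>))"
      unfolding exchange_cup_cap ..
    with Cross show ?thesis by (simp only: act.simps strands_in.simps strands_out.simps act_linear)
  qed
  then show ?thesis by (simp add: exchange)
\<comment> \<open>In a slide the cap-cup term contains a zigzag. Straightening it turns both sides
  into the same combination of an event at \<open>i\<close> and one at \<open>i + 1\<close>, because
  changing the crossing type swaps the weights.\<close>
qed (simp_all add: cup_op_linear cap_op_linear add.commute)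

lemma ev_smoothing:
  "ev [(Cross b, i)] \<phi> = (\<lambda>s. q * ev (smoothing_A b i) \<phi> s + q' * ev (smoothing_B b i) \<phi> s)"
  by (cases b) (simp_all add: add.commute)

text \<open>Stated for shifted words so that it applies to both factors of a juxtaposition:
  \<open>k = 0\<close> for the left one, the number of upper endpoints for the right one.\<close>

lemma ev_locally_related:
  assumes "locally_related isotopy_move m n w w'"
  shows "ev (shift k w) \<phi> = ev (shift k w') \<phi>"
  using assms ev_isotopy_move[OF isotopy_move_shift]
  by (auto simp: locally_related_def)

lemma ev_isotopy:
  assumes "(w, w') \<in> isotopy m n"
  shows "ev (shift k w) \<phi> = ev (shift k w') \<phi>"
proof -
  have "equivclp (locally_related isotopy_move m n) w w'"
    using assms by (simp add: isotopy_def)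
  then show ?thesis
    by (induction rule: equivclp_induct) (auto dest: ev_locally_related[where k = k and \<phi> = \<phi>])
qed

end

locale kauffman_model =
  fixes q q' :: "'r::comm_ring_1"
  assumes inverse: "q * q' = 1"
begin

text \<open>The customary choice uses one matrix for cups and caps and needs a square root of -1.
  Rescaling cup and cap by inverse factors brings all entries into the ring generated by
  \<open>q\<close> and \<open>q'\<close>.\<close>

fun cup :: "bool \<Rightarrow> bool \<Rightarrow> 'r" where
  "cup False True = 1"
| "cup True False = - (q' * q')"
| "cup _ _ = 0"

fun cap :: "bool \<Rightarrow> bool \<Rightarrow> 'r" where
  "cap False True = - (q * q)"
| "cap True False = 1"
| "cap _ _ = 0"

lemma cancel: "q * (q' * x) = x" "q' * (q * x) = x"
  using inverse by (simp_all add: mult.assoc[symmetric] mult.commute)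

sublocale tensor_model cup cap q q' "- (q * q) - q' * q'"
proof
  fix a c
  show "(\<Sum>b\<in>UNIV. cup a b * cap b c) = of_bool (a = c)"
    using inverse by (cases a; cases c) (simp_all add: UNIV_bool cancel algebra_simps)
  show "(\<Sum>b\<in>UNIV. cap a b * cup b c) = of_bool (a = c)"
    using inverse by (cases a; cases c) (simp_all add: UNIV_bool cancel algebra_simps)
qed (simp add: UNIV_bool)

definition twist :: "bool \<Rightarrow> 'r" where
  "twist b = - (weight b ^ 3)"

lemma weight_mult: "weight b * weight (\<not> b) = 1"
  using inverse by (cases b) (simp_all add: mult.commute)

lemma twist_mult: "twist b * twist (\<not> b) = 1"
  unfolding twist_def using weight_mult[of b] by (metis minus_mult_minus power_mult_distrib power_one)

text \<open>One smoothing of the kink leaves a strand and a circle, the other a strand with zigzags: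
  with x = \<open>weight b\<close> the factor is x (-x^2 - x^-2) + x^-1 = -x^3.\<close>

lemma ev_R1:
  "ev [(Cup, i), (Cross b, Suc i), (Cap, i)] \<phi> = (\<lambda>s. twist b * ev [] \<phi> s)"
  "ev [(Cup, Suc i), (Cross b, i), (Cap, Suc i)] \<phi> = (\<lambda>s. twist b * ev [] \<phi> s)"
  by (cases b; simp add: cup_op_linear fun_eq_iff twist_def power3_eq_cube cancel algebra_simps)+

text \<open>With U the cap followed by the cup, U^2 = \<delta> U, so (x + x^-1 U)(x^-1 + x U) = 1 +
  (x^2 + x^-2 + \<delta>) U = 1.\<close>

lemma ev_R2: "ev [(Cross b, i), (Cross (\<not> b), i)] \<phi> = ev [] \<phi>"
  by (cases b) (simp_all add: cup_op_linear cap_op_linear fun_eq_iff cancel algebra_simps)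

text \<open>Expanding the crossings gives combinations of Temperley-Lieb words in the cap-cup
  operators at \<open>i\<close> and \<open>Suc i\<close>; reducing these by circles and zigzags
  makes the two sides agree.\<close>

lemma ev_R3:
  assumes "a = b \<or> b = c"
  shows "ev [(Cross a, i), (Cross b, Suc i), (Cross c, i)] \<phi>
       = ev [(Cross c, Suc i), (Cross b, i), (Cross a, Suc i)] \<phi>"
  using assms
  by (cases a; cases b; cases c)
     (simp_all add: cup_op_linear cap_op_linear fun_eq_iff cancel algebra_simps)

text \<open>In (x + x^-1 U)^3 with U^2 = \<delta> U the coefficient of U is x - x^-3 + x^-7 = x^-7
  (x^8 - x^4 + 1), so only x^3 survives.\<close>

lemma ev_three_move:
  assumes "q ^ 8 - q ^ 4 + 1 = 0"
  shows "ev [(Cross b, i), (Cross b, i), (Cross b, i)] \<phi> = (\<lambda>s. weight b ^ 3 * ev [] \<phi> s)"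
proof
  fix s
  have power_eq: "x ^ 4 = x * x * x * x" "x ^ 8 = x * x * x * x * x * x * x * x" for x :: 'r
    by (simp_all add: numeral_eq_Suc algebra_simps)
  \<comment> \<open>The polynomial is palindromic, so the inverse of a root is again a root; this
    serves the opposite handedness.\<close>
  have "q' ^ 8 - q' ^ 4 + 1 = q' ^ 8 * (q ^ 8 - q ^ 4 + 1)"
    using inverse by (simp add: power_eq cancel algebra_simps)
  then have root': "q' ^ 8 - q' ^ 4 + 1 = 0"
    using assms by simp
  let ?e = "cap_op i (cup_op i \<phi>) s"
  \<comment> \<open>The seventh power is the x^-7 split off from the coefficient of U; the vanishing
    coefficient is then rewritten in the right-nested form that \<open>cancel\<close>
    produces.\<close>
  have "q' * q' * q' * q' * q' * q' * q' * ?e * (q ^ 8 - q ^ 4 + 1) = 0"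
    "q * q * q * q * q * q * q * ?e * (q' ^ 8 - q' ^ 4 + 1) = 0"
    using assms root' by simp_all
  then have
    "q * ?e + q' * (q' * (q' * (q' * (q' * (q' * (q' * ?e)))))) = q' * (q' * (q' * ?e))"
    "q' * ?e + q * (q * (q * (q * (q * (q * (q * ?e)))))) = q * (q * (q * ?e))"
    using inverse by (simp_all add: power_eq cancel algebra_simps)
  then show "ev [(Cross b, i), (Cross b, i), (Cross b, i)] \<phi> s = weight b ^ 3 * ev [] \<phi> s"
    by (cases b)
       (simp_all add: cup_op_linear cap_op_linear cancel algebra_simps power3_eq_cube)
qed

end

lemma is_diagram_append:
  "is_diagram m n (u @ v) \<longleftrightarrow> (\<exists>k. is_diagram m k u \<and> is_diagram k n v)"
proof (induction u arbitrary: m)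
  case (Cons x u)
  then show ?case by (cases x) auto
qed simp

section \<open>Reduction of diagrams by skein relations\<close>

definition crossings :: "diagram \<Rightarrow> nat" where
  "crossings w = length (filter (\<lambda>(s, i). s \<noteq> Cup \<and> s \<noteq> Cap) w)"

definition caps :: "diagram \<Rightarrow> nat" where
  "caps w = length (filter (\<lambda>(s, i). s = Cap) w)"

text \<open>The inversions of a word with respect to the order caps first, cups last: the second
  component of the termination measure in \<open>skein_induct\<close>.\<close>

fun cups_below_caps :: "diagram \<Rightarrow> nat" where
  "cups_below_caps [] = 0"
| "cups_below_caps ((s, i) # w) = (if s = Cup then caps w else 0) + cups_below_caps w"

lemma crossings_simps [simp]:
  "crossings [] = 0"
  "crossings ((s, i) # w) = (if s = Cup \<or> s = Cap then 0 else 1) + crossings w"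
  "crossings (u @ v) = crossings u + crossings v"
  by (auto simp: crossings_def)

lemma caps_simps [simp]:
  "caps [] = 0"
  "caps ((s, i) # w) = (if s = Cap then 1 else 0) + caps w"
  "caps (u @ v) = caps u + caps v"
  by (auto simp: caps_def)

lemma crossings_eq_0_iff: "crossings w = 0 \<longleftrightarrow> (\<forall>(s, i)\<in>set w. \<forall>b. s \<noteq> Cross b)"
proof (induction w)
  case (Cons x w)
  then show ?case by (cases x; cases "fst x") auto
qed simp

text \<open>Induction from the bottom: a cup in front forces the cap part of the remaining word to
  be empty, since its first cap would sit directly above that cup.\<close>

lemma cap_cup_factorisation:
  assumes "crossings w = 0" and "\<forall>u i j v. w \<noteq> u @ [(Cup, i), (Cap, j)] @ v"
  shows "\<exists>u v. w = u @ v \<and> fst ` set u \<subseteq> {Cap} \<and> fst ` set v \<subseteq> {Cup}"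
  using assms
proof (induction w)
  case (Cons x w)
  obtain s i where x: "x = (s, i)" by (cases x)
  have "\<forall>u i j v. w \<noteq> u @ [(Cup, i), (Cap, j)] @ v"
    using Cons.prems(2) by (metis append_Cons)
  moreover have "crossings w = 0"
    using Cons.prems(1) x by simp
  ultimately obtain u v where uv: "w = u @ v" "fst ` set u \<subseteq> {Cap}" "fst ` set v \<subseteq> {Cup}"
    using Cons.IH by blast
  have "s = Cup \<or> s = Cap"
    using Cons.prems(1) x by (auto split: if_splits)
  then show ?case
  proof
    assume "s = Cap"
    then have "x # w = (x # u) @ v \<and> fst ` set (x # u) \<subseteq> {Cap} \<and> fst ` set v \<subseteq> {Cup}"
      using uv x by simp
    then show ?case by blast
  next
    assume s: "s = Cup"
    have "u = []"
    proof (cases u)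
      case u: (Cons y u')
      then obtain j where "y = (Cap, j)" using uv(2) by (cases y) auto
      then have "x # w = [] @ [(Cup, i), (Cap, j)] @ (u' @ v)"
        using u uv(1) x s by simp
      then show ?thesis using Cons.prems(2) by blast
    qed
    then have "x # w = [] @ (x # v) \<and> fst ` set [] \<subseteq> {Cap} \<and> fst ` set (x # v) \<subseteq> {Cup}"
      using uv x s by simp
    then show ?case by blast
  qed
qed simp

lemma isotopyI:
  assumes "locally_related isotopy_move m n w w' \<or> locally_related isotopy_move m n w' w"
  shows "(w, w') \<in> isotopy m n"
proof -
  have "w \<in> diagrams m n"
    using assms by (auto simp: locally_related_def)
  moreover have "equivclp (locally_related isotopy_move m n) w w'"
    using assms by (auto intro: r_into_equivclp equivclp_sym)
  ultimately show ?thesis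
    by (simp add: isotopy_def)
qed

lemma crossings_isotopy:
  assumes "(w, w') \<in> isotopy m n" "crossings w = 0" shows "crossings w' = 0"
proof -
  have step: "crossings x = crossings y" if "locally_related isotopy_move m n x y" for x y
    using that by (auto simp: locally_related_def elim!: isotopy_move.cases)
  have "equivclp (locally_related isotopy_move m n) w w'"
    using assms by (simp add: isotopy_def)
  then have "crossings w = crossings w'"
    by (induction rule: equivclp_induct) (auto dest: step)
  with assms show ?thesis by simp
qed

text \<open>The cup creates the strands \<open>i\<close>, \<open>i + 1\<close> and the cap joins
  \<open>j\<close>, \<open>j + 1\<close>. Two common strands make a circle, one makes a zigzag, and
  with none the two events can be exchanged.\<close>

lemma cup_cap_cases:
  assumes w: "u @ [(Cup, i), (Cap, j)] @ v \<in> diagrams m n"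
  obtains (loop) "i = j" "u @ v \<in> diagrams m n"
    | (isotopic) z where "(u @ [(Cup, i), (Cap, j)] @ v, u @ z @ v) \<in> isotopy m n"
        "u @ z @ v \<in> diagrams m n" "z = [] \<or> (\<exists>i' j'. z = [(Cap, j'), (Cup, i')])"
proof -
  have iso: ?thesis
    if L: "isotopy_move [(Cup, i), (Cap, j)] z \<or> isotopy_move z [(Cup, i), (Cap, j)]"
      and D: "u @ z @ v \<in> diagrams m n"
      and z: "z = [] \<or> (\<exists>i' j'. z = [(Cap, j'), (Cup, i')])" for z
  proof (rule isotopic[OF isotopyI D z])
    show "locally_related isotopy_move m n (u @ [(Cup, i), (Cap, j)] @ v) (u @ z @ v) \<or>
          locally_related isotopy_move m n (u @ z @ v) (u @ [(Cup, i), (Cap, j)] @ v)"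
      unfolding locally_related_def using L w D by blast
  qed
  have "j = i \<or> j = i + 1 \<or> i = j + 1 \<or> j = i + 2 + (j - i - 2) \<or> i = j + 2 + (i - j - 2)"
    by arith
  then consider "j = i" | "j = i + 1" | "i = j + 1" | d where "j = i + 2 + d" | d where "i = j + 2 + d"
    by blast
  then show ?thesis
  proof cases
    case 1
    then show ?thesis using w by (intro loop) (auto simp: diagrams_def is_diagram_append)
  next
    case 2
    then show ?thesis using w isotopy_move.zigzag_left[of i]
      by (intro iso[of "[]"]) (auto simp: diagrams_def is_diagram_append)
  next
    case 3
    then show ?thesis using w isotopy_move.zigzag_right[of j]
      by (intro iso[of "[]"]) (auto simp: diagrams_def is_diagram_append)
  next
    case (4 d)
    have "is_diagram k l [(Cap, i + d), (Cup, i)]" if "is_diagram k l [(Cup, i), (Cap, j)]" for k l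
      using that 4 by auto
    then show ?thesis using w isotopy_move.exchange[of Cup i Cap d] 4
      by (intro iso[of "[(Cap, i + d), (Cup, i)]"])
        (simp_all only: diagrams_def is_diagram_append mem_Collect_eq strands_in.simps strands_out.simps
          add_0_right, blast+)
  next
    case (5 d)
    have "is_diagram k l [(Cap, j), (Cup, j + d)]" if "is_diagram k l [(Cup, i), (Cap, j)]" for k l
      using that 5 by auto
    then show ?thesis using w isotopy_move.exchange[of Cap j Cup d] 5
      by (intro iso[of "[(Cap, j), (Cup, j + d)]"])
        (simp_all only: diagrams_def is_diagram_append mem_Collect_eq strands_in.simps strands_out.simps
          add_0_right, blast+)
  qed
qed

lemma smoothing_diagrams:
  assumes "u @ [(Cross b, i)] @ v \<in> diagrams m n"
  shows "u @ smoothing_A b i @ v \<in> diagrams m n" "u @ smoothing_B b i @ v \<in> diagrams m n"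
proof -
  obtain k l where kl: "is_diagram m k u" "is_diagram k l [(Cross b, i)]" "is_diagram l n v"
    using assms unfolding diagrams_def is_diagram_append mem_Collect_eq by blast
  obtain j where "k = i + 2 + j"
    using kl(2) by (auto simp: le_iff_add)
  with kl(2) have "is_diagram k l (smoothing_A b i)" "is_diagram k l (smoothing_B b i)"
    by (cases b; simp)+
  then show "u @ smoothing_A b i @ v \<in> diagrams m n" "u @ smoothing_B b i @ v \<in> diagrams m n"
    using kl unfolding diagrams_def is_diagram_append mem_Collect_eq by blast+
qed
text \<open>Termination is lexicographic. Smoothing removes a crossing, whatever it does to the
  order of cups and caps; in a crossingless word, treating a cup directly below a cap lowers
  \<open>cups_below_caps\<close>.\<close>

lemma skein_induct [consumes 1, case_names caps_then_cups isotopic crossing loop]: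
  assumes "w \<in> diagrams m n"
    and normal: "\<And>u v. u @ v \<in> diagrams m n \<Longrightarrow> fst ` set u \<subseteq> {Cap} \<Longrightarrow>
       fst ` set v \<subseteq> {Cup} \<Longrightarrow> Q (u @ v)"
    and isotopic: "\<And>w w'. (w, w') \<in> isotopy m n \<Longrightarrow> Q w' \<Longrightarrow> Q w"
    and crossing: "\<And>u b i v. u @ [(Cross b, i)] @ v \<in> diagrams m n \<Longrightarrow>
       Q (u @ smoothing_A b i @ v) \<Longrightarrow> Q (u @ smoothing_B b i @ v) \<Longrightarrow>
       u @ smoothing_A b i @ v \<in> diagrams m n \<Longrightarrow> u @ smoothing_B b i @ v \<in> diagrams m n \<Longrightarrow>
       Q (u @ [(Cross b, i)] @ v)"
    and loop: "\<And>u i v. u @ [(Cup, i), (Cap, i)] @ v \<in> diagrams m n \<Longrightarrow> u @ v \<in> diagrams m n \<Longrightarrow>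
       Q (u @ v) \<Longrightarrow> Q (u @ [(Cup, i), (Cap, i)] @ v)"
  shows "Q w"
  using wf_measures[of "[crossings, cups_below_caps]"] assms(1)
proof (induction w rule: wf_induct_rule)
  case (less w)
  consider (cross) "crossings w \<noteq> 0"
    | (pair) u i j v where "crossings w = 0" "w = u @ [(Cup, i), (Cap, j)] @ v"
    | (none) "crossings w = 0" "\<And>u i j v. w \<noteq> u @ [(Cup, i), (Cap, j)] @ v"
    by blast
  then show ?case
  proof cases
    case cross
    then obtain b i where "(Cross b, i) \<in> set w"
      by (auto simp: crossings_eq_0_iff)
    then obtain u v where w: "w = u @ [(Cross b, i)] @ v"
      by (auto simp: in_set_conv_decomp)
    have D: "u @ smoothing_A b i @ v \<in> diagrams m n" "u @ smoothing_B b i @ v \<in> diagrams m n"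
      using smoothing_diagrams less.prems unfolding w by auto
    have "crossings (smoothing_A b i) = 0" "crossings (smoothing_B b i) = 0"
      by (cases b; simp)+
    then have "Q (u @ smoothing_A b i @ v)" "Q (u @ smoothing_B b i @ v)"
      using D by (auto intro!: less.IH simp: w)
    then show ?thesis unfolding w
      using less.prems D by (intro crossing) (simp_all add: w)
  next
    case (pair u i j v)
    have D: "u @ [(Cup, i), (Cap, j)] @ v \<in> diagrams m n"
      using less.prems pair by simp
    \<comment> \<open>The inversion of the adjacent pair disappears, and no cup further down gains a
      cap above it.\<close>
    have m: "cups_below_caps (u @ z @ v) < cups_below_caps (u @ [(Cup, i), (Cap, j)] @ v)"
      if "z = [] \<or> (\<exists>i' j'. z = [(Cap, j'), (Cup, i')])" for z
    proof (induction u)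
      case Nil
      show ?case using that by auto
    next
      case (Cons x u)
      have "caps (u @ z @ v) \<le> caps (u @ [(Cup, i), (Cap, j)] @ v)"
        using that by auto
      with Cons.IH show ?case by (cases x) (simp add: add_le_less_mono)
    qed
    from D show ?thesis
    proof (cases rule: cup_cap_cases)
      case loop': loop
      have "Q (u @ v)"
        using less.IH[of "u @ v"] m[of "[]"] loop' pair by auto
      then show ?thesis unfolding pair loop'(1)
        using D loop' by (intro loop) simp_all
    next
      case iso: (isotopic z)
      have "crossings (u @ z @ v) = 0"
        using iso(3) pair by auto
      then have "Q (u @ z @ v)"
        using less.IH[of "u @ z @ v"] iso m[of z] pair by auto
      then show ?thesis using isotopic iso(1) pair by simp
    qed
  next
    case none
    then obtain u v where "w = u @ v" "fst ` set u \<subseteq> {Cap}" "fst ` set v \<subseteq> {Cup}"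
      using cap_cup_factorisation[of w] by blast
    then show ?thesis using normal less.prems by simp
  qed
qed

section \<open>Counting closed loops by colourings\<close>

lemma width_0 [simp]: "width m w 0 = m"
  by (simp add: width_def)

lemma width_Cons [simp]:
  "width m ((s, i) # w) (Suc t) = width (m - strands_in s + strands_out s) w t"
  by (simp add: width_def)

lemma width_Suc:
  assumes "t < length w" "w ! t = (s, i)"
  shows "width m w (Suc t) = width m w t - strands_in s + strands_out s"
  using assms by (simp add: width_def take_Suc_conv_app_nth)

lemma width_length: "is_diagram m n w \<Longrightarrow> width m w (length w) = n"
  by (induction w arbitrary: m) auto

lemma finite_points: "finite (points m w)"
proof -
  have "points m w = (SIGMA t:{..length w}. {..<width m w t})"
    by (auto simp: points_def)
  then show ?thesis by simp
qed

text \<open>From a level within the caps every strand can be followed down to the bottom, and from a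
  level within the cups up to the top, so every component meets an endpoint level.\<close>

lemma closed_loops_caps_then_cups:
  assumes "fst ` set u \<subseteq> {Cap}" "fst ` set v \<subseteq> {Cup}"
  shows "closed_loops m (u @ v) = 0"
proof -
  let ?w = "u @ v"
  have down: "p < width m ?w t \<Longrightarrow> \<exists>p'<m. equivclp (adjacent m ?w) (t, p) (0, p')"
    if "t \<le> length u" for t p
    using that
  proof (induction t arbitrary: p)
    case 0
    then show ?case by (auto intro: exI[of _ p])
  next
    case (Suc t)
    obtain s i where si: "?w ! t = (s, i)" by (cases "?w ! t")
    have "(s, i) \<in> set u"
      using Suc.prems si by (metis Suc_le_lessD nth_append nth_mem)
    then have s: "s = Cap" using assms by auto
    have t: "t < length ?w" using Suc.prems by simp
    have "\<exists>p''<width m ?w t. adjacent m ?w (t, p'') (Suc t, p)"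
    proof (cases "p < i")
      case True
      then show ?thesis using adjacent.left_of_event[OF t si] Suc.prems width_Suc[OF t si, of m] s
        by (auto intro!: exI[of _ p])
    next
      case False
      then obtain d where d: "p = i + d" by (metis le_iff_add not_less)
      then show ?thesis using adjacent.right_of_event[OF t si, of d m] Suc.prems width_Suc[OF t si, of m] s
        by (auto intro!: exI[of _ "i + 2 + d"])
    qed
    then obtain p'' where "p'' < width m ?w t" "adjacent m ?w (t, p'') (Suc t, p)"
      by blast
    moreover obtain p' where "p' < m" "equivclp (adjacent m ?w) (t, p'') (0, p')"
      using Suc.IH[of p''] Suc.prems calculation by auto
    ultimately show ?case
      by (meson converse_r_into_equivclp equivclp_trans)
  qed
  \<comment> \<open>\<open>k\<close> counts levels from the top, so that induction on
    \<open>k\<close> proceeds downwards through the cups.\<close>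
  have up: "p < width m ?w (length ?w - k) \<Longrightarrow> \<exists>p'<width m ?w (length ?w).
      equivclp (adjacent m ?w) (length ?w - k, p) (length ?w, p')"
    if "k \<le> length v" for k p
    using that
  proof (induction k arbitrary: p)
    case 0
    then show ?case by (auto intro: exI[of _ p])
  next
    case (Suc k)
    define t where "t = length ?w - Suc k"
    have St: "length ?w - k = Suc t" using Suc.prems by (simp add: t_def)
    obtain s i where si: "?w ! t = (s, i)" by (cases "?w ! t")
    have t: "t < length ?w" using Suc.prems by (simp add: t_def)
    have "(s, i) \<in> set v"
      using Suc.prems si
      by (auto simp: t_def nth_append split: if_splits intro: nth_mem)
        (metis nth_mem diff_less less_le_trans zero_less_Suc)
    then have s: "s = Cup" using assms by auto
    have p: "p < width m ?w t" using Suc.prems by (simp add: t_def)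
    have "\<exists>p''<width m ?w (Suc t). adjacent m ?w (t, p) (Suc t, p'')"
    proof (cases "p < i")
      case True
      then show ?thesis using adjacent.left_of_event[OF t si] p width_Suc[OF t si, of m] s
        by (auto intro!: exI[of _ p] )
    next
      case False
      then obtain d where d: "p = i + d" by (metis le_iff_add not_less)
      then show ?thesis using adjacent.right_of_event[OF t si, of d m] p width_Suc[OF t si, of m] s
        by (auto intro!: exI[of _ "i + 2 + d"] )
    qed
    then obtain p'' where "p'' < width m ?w (Suc t)" "adjacent m ?w (t, p) (Suc t, p'')"
      by blast
    moreover obtain p' where "p' < width m ?w (length ?w)"
        "equivclp (adjacent m ?w) (Suc t, p'') (length ?w, p')"
      using Suc.IH[of p''] Suc.prems calculation unfolding St by auto
    ultimately show ?case
      unfolding t_def[symmetric] by (meson r_into_equivclp equivclp_trans)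
  qed
  have "\<exists>(t, p)\<in>C. t = 0 \<or> t = length ?w" if "C \<in> components m ?w" for C
  proof -
    let ?R = "{(x, y). x \<in> points m ?w \<and> y \<in> points m ?w \<and> equivclp (adjacent m ?w) x y}"
    from that obtain t p where tp: "(t, p) \<in> points m ?w" and C: "C = ?R `` {(t, p)}"
      unfolding components_def quotient_def by auto
    show ?thesis
    proof (cases "t \<le> length u")
      case True
      then obtain p' where "p' < m" "equivclp (adjacent m ?w) (t, p) (0, p')"
        using down[of t p] tp by (auto simp: points_def)
      then have "(0, p') \<in> C" using tp C by (auto simp: points_def)
      then show ?thesis by blast
    next
      case False
      define k where "k = length ?w - t"
      have k: "t = length ?w - k" "k \<le> length v"
        using False tp by (auto simp: k_def points_def)
      obtain p' where "p' < width m ?w (length ?w)"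
          "equivclp (adjacent m ?w) (t, p) (length ?w, p')"
        using up[OF k(2), of p, folded k(1)] tp by (auto simp: points_def)
      then have "(length ?w, p') \<in> C" using tp C by (auto simp: points_def)
      then show ?thesis by blast
    qed
  qed
  then have "{C \<in> components m ?w. \<forall>(t, p)\<in>C. t \<noteq> 0 \<and> t \<noteq> length ?w} = {}"
    by fastforce
  then show ?thesis
    by (simp only: closed_loops_def card.empty)
qed

text \<open>A two-colouring that is constant on components, encoded as the set of points of one
  colour.\<close>

definition colourings :: "nat \<Rightarrow> diagram \<Rightarrow> (nat \<times> nat) set set" where
  "colourings m w = {X. X \<subseteq> points m w \<and> (\<forall>x y. adjacent m w x y \<longrightarrow> (x \<in> X \<longleftrightarrow> y \<in> X))}"

lemma finite_colourings: "finite (colourings m w)"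
  by (rule finite_subset[of _ "Pow (points m w)"]) (auto simp: colourings_def finite_points)

lemma points_Cons:
  "points m ((s, i) # w) = Pair 0 ` {..<m} \<union> apfst Suc ` points (m - strands_in s + strands_out s) w"
proof -
  have "(t, p) \<in> points m ((s, i) # w) \<longleftrightarrow>
      (t, p) \<in> Pair 0 ` {..<m} \<union> apfst Suc ` points (m - strands_in s + strands_out s) w" for t p
    by (cases t) (auto simp: points_def image_iff)
  then show ?thesis by auto
qed

lemmas adjacent_Suc_intros = adjacent.intros(3-6)[unfolded Suc_eq_plus1[symmetric]]

text \<open>Not a rewrite rule: the left-hand side occurs again on the right, for \<open>w = []\<close>.\<close>

lemma adjacent_Cons:
  "adjacent m ((s, i) # w) x y \<longleftrightarrow> adjacent m [(s, i)] x y \<or>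
     (\<exists>x' y'. x = apfst Suc x' \<and> y = apfst Suc y' \<and>
        adjacent (m - strands_in s + strands_out s) w x' y')" (is "?L \<longleftrightarrow> ?R")
proof
  assume ?L
  then show ?R
  proof cases
    case (left_of_event t s' i' p)
    then show ?thesis by (cases t) (auto intro: adjacent.intros adjacent_Suc_intros)
  next
    case (right_of_event t s' i' d)
    then show ?thesis by (cases t) (auto intro: adjacent.intros adjacent_Suc_intros)
  next
    case (cup t i')
    then show ?thesis by (cases t) (auto intro: adjacent.intros adjacent_Suc_intros)
  next
    case (cap t i')
    then show ?thesis by (cases t) (auto intro: adjacent.intros adjacent_Suc_intros)
  next
    case (cross_right t b i')
    then show ?thesis
      by (cases t) (auto intro: adjacent.intros adjacent_Suc_intros)
  next
    case (cross_left t b i')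
    then show ?thesis
      by (cases t) (auto intro: adjacent.intros adjacent_Suc_intros)
  qed
next
  assume ?R
  then show ?L
  proof
    assume "adjacent m [(s, i)] x y"
    then show ?L
      by cases (auto intro: adjacent.intros adjacent_Suc_intros simp: less_Suc_eq_0_disj)
  next
    assume "\<exists>x' y'. x = apfst Suc x' \<and> y = apfst Suc y' \<and>
        adjacent (m - strands_in s + strands_out s) w x' y'"
    then obtain x' y' where xy: "x = apfst Suc x'" "y = apfst Suc y'"
      and "adjacent (m - strands_in s + strands_out s) w x' y'" by blast
    from this(3) show ?L
      unfolding xy by cases (auto intro: adjacent.intros adjacent_Suc_intros)
  qed
qed


definition colourings_from :: "nat \<Rightarrow> diagram \<Rightarrow> (nat \<Rightarrow> bool) \<Rightarrow> (nat \<times> nat) set set" where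
  "colourings_from m w \<sigma> = {X \<in> colourings m w. \<forall>p<m. (0, p) \<in> X \<longleftrightarrow> \<sigma> p}"

definition extend_down :: "nat \<Rightarrow> (nat \<Rightarrow> bool) \<Rightarrow> (nat \<times> nat) set \<Rightarrow> (nat \<times> nat) set" where
  "extend_down m \<sigma> X = Pair 0 ` {p. p < m \<and> \<sigma> p} \<union> apfst Suc ` X"

lemma mem_extend_down [simp]:
  "(0, p) \<in> extend_down m \<sigma> X \<longleftrightarrow> p < m \<and> \<sigma> p"
  "(Suc t, p) \<in> extend_down m \<sigma> X \<longleftrightarrow> (t, p) \<in> X"
  "apfst Suc x \<in> extend_down m \<sigma> X \<longleftrightarrow> x \<in> X"
  by (auto simp: extend_down_def image_iff apfst_def map_prod_def split: prod.splits)

text \<open>Restriction to the levels above the first event is a bijection: level 0 is prescribed by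
  \<open>\<sigma>\<close>, and the arcs at the first event become a condition on the restricted
  colouring.\<close>

lemma card_colourings_from_Cons:
  "card (colourings_from m ((s, i) # w) \<sigma>) =
     card {X \<in> colourings (m - strands_in s + strands_out s) w.
       \<forall>x y. adjacent m [(s, i)] x y \<longrightarrow> (x \<in> extend_down m \<sigma> X \<longleftrightarrow> y \<in> extend_down m \<sigma> X)}"
    (is "card ?L = card ?R")
proof -
  have "apfst Suc -` extend_down m \<sigma> X = X" for X
    by auto
  then have "inj_on (extend_down m \<sigma>) ?R"
    by (rule inj_on_inverseI)
  moreover have "extend_down m \<sigma> ` ?R = ?L"
  proof (intro equalityI subsetI)
    fix Y assume "Y \<in> extend_down m \<sigma> ` ?R"
    then obtain X where Y: "Y = extend_down m \<sigma> X" and X: "X \<in> ?R"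
      by blast
    have "Y \<subseteq> points m ((s, i) # w)"
      using X by (auto simp: Y extend_down_def points_Cons colourings_def)
    moreover have "x \<in> Y \<longleftrightarrow> y \<in> Y" if "adjacent m ((s, i) # w) x y" for x y
      using adjacent_Cons[THEN iffD1, OF that]
    proof
      assume "adjacent m [(s, i)] x y"
      then show ?thesis using X unfolding Y by blast
    next
      assume "\<exists>x' y'. x = apfst Suc x' \<and> y = apfst Suc y' \<and>
        adjacent (m - strands_in s + strands_out s) w x' y'"
      then obtain x' y' where "x = apfst Suc x'" "y = apfst Suc y'"
        "adjacent (m - strands_in s + strands_out s) w x' y'" by blast
      moreover from this(3) have "x' \<in> X \<longleftrightarrow> y' \<in> X"
        using X unfolding colourings_def by blast
      ultimately show ?thesis unfolding Y by simp
    qed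
    ultimately show "Y \<in> ?L"
      unfolding colourings_from_def colourings_def by (simp add: Y)
  next
    fix Y assume "Y \<in> ?L"
    then have Y: "Y \<subseteq> points m ((s, i) # w)" "\<forall>p<m. (0, p) \<in> Y \<longleftrightarrow> \<sigma> p"
      and adj: "\<And>x y. adjacent m ((s, i) # w) x y \<Longrightarrow> x \<in> Y \<longleftrightarrow> y \<in> Y"
      unfolding colourings_from_def colourings_def by blast+
    define X where "X = apfst Suc -` Y"
    have "x \<in> Y \<longleftrightarrow> x \<in> extend_down m \<sigma> X" for x
    proof -
      obtain t p where x: "x = (t, p)" by (cases x)
      show ?thesis
      proof (cases t)
        case 0
        have "(0, p) \<in> Y \<Longrightarrow> p < m" using Y(1) by (auto simp: points_def)
        then show ?thesis using Y(2) x 0 by auto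
      next
        case (Suc t')
        then show ?thesis using x by (simp add: X_def)
      qed
    qed
    then have YX: "Y = extend_down m \<sigma> X"
      by (rule set_eqI)
    moreover have "X \<subseteq> points (m - strands_in s + strands_out s) w"
    proof -
      have "apfst Suc x \<in> points m ((s, i) # w) \<Longrightarrow>
          x \<in> points (m - strands_in s + strands_out s) w" for x
        by (cases x) (simp add: points_def)
      then show ?thesis using Y(1) by (auto simp: X_def)
    qed
    moreover have "x \<in> X \<longleftrightarrow> y \<in> X" if "adjacent (m - strands_in s + strands_out s) w x y" for x y
      using adj[of "apfst Suc x" "apfst Suc y"] adjacent_Cons[of m s i w] that
      unfolding X_def vimage_eq by blast
    moreover have "x \<in> Y \<longleftrightarrow> y \<in> Y" if "adjacent m [(s, i)] x y" for x y
      using adj[of x y] adjacent_Cons[of m s i w x y] that by blast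
    ultimately have "X \<in> ?R"
      unfolding colourings_def by blast
    with YX show "Y \<in> extend_down m \<sigma> ` ?R"
      by blast
  qed
  ultimately show ?thesis
    using card_image[of "extend_down m \<sigma>" ?R] by argo
qed

lemma adjacent_Cup:
  "adjacent m [(Cup, i)] x y \<longleftrightarrow> (\<exists>p<i. x = (0, p) \<and> y = (1, p)) \<or>
     (\<exists>d. i + d < m \<and> x = (0, i + d) \<and> y = (1, i + 2 + d)) \<or> x = (1, i) \<and> y = (1, Suc i)"
  by (auto simp: adjacent.simps)

lemma adjacent_Cap:
  "adjacent m [(Cap, i)] x y \<longleftrightarrow> (\<exists>p<i. x = (0, p) \<and> y = (1, p)) \<or>
     (\<exists>d. i + 2 + d < m \<and> x = (0, i + 2 + d) \<and> y = (1, i + d)) \<or> x = (0, i) \<and> y = (0, Suc i)"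
  by (auto simp: adjacent.simps)

text \<open>The arc of the cup forces one common colour \<open>a\<close> on its two strands, and all
  other colours on the new level are carried over. The two families are disjoint because
  \<open>a\<close> can be read off at position \<open>i\<close>.\<close>

lemma card_colourings_from_Cup:
  assumes "i \<le> m"
  shows "card (colourings_from m ((Cup, i) # w) \<sigma>) =
    (\<Sum>a\<in>UNIV. card (colourings_from (m + 2) w (insert_pair i a a \<sigma>)))"
proof -
  have eq: "(\<forall>x y. adjacent m [(Cup, i)] x y \<longrightarrow> (x \<in> extend_down m \<sigma> X \<longleftrightarrow> y \<in> extend_down m \<sigma> X)) \<longleftrightarrow>
      (\<exists>a. \<forall>p<m + 2. (0, p) \<in> X \<longleftrightarrow> insert_pair i a a \<sigma> p)" (is "?A \<longleftrightarrow> ?B") for X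
  proof
    assume A: ?A
    have "(0, p) \<in> X \<longleftrightarrow> insert_pair i ((0, i) \<in> X) ((0, i) \<in> X) \<sigma> p" if "p < m + 2" for p
    proof -
      consider "p < i" | "p = i" | "p = Suc i" | d where "p = i + 2 + d"
        by (metis add_2_eq_Suc' le_iff_add not_less_eq_eq le_antisym not_less)
      then show ?thesis
      proof cases
        case 1
        then show ?thesis using A[rule_format, of "(0, p)" "(1, p)"] assms
          by (auto simp: adjacent_Cup insert_pair_def)
      next
        case 3
        then show ?thesis using A[rule_format, of "(1, i)" "(1, p)"]
          by (auto simp: adjacent_Cup insert_pair_def)
      next
        case (4 d)
        then show ?thesis using A[rule_format, of "(0, i + d)" "(1, i + 2 + d)"] that
          by (auto simp: adjacent_Cup insert_pair_def)
      qed (simp add: insert_pair_def)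
    qed
    then show ?B by blast
  next
    assume ?B
    then obtain a where "\<forall>p<m + 2. (0, p) \<in> X \<longleftrightarrow> insert_pair i a a \<sigma> p" ..
    then show ?A using assms by (auto simp: adjacent_Cup insert_pair_def)
  qed
  have "card (colourings_from m ((Cup, i) # w) \<sigma>) =
      card (\<Union>a. colourings_from (m + 2) w (insert_pair i a a \<sigma>))"
    unfolding card_colourings_from_Cons eq
    unfolding colourings_from_def by (intro arg_cong[where f = card]) auto
  also have "\<dots> = (\<Sum>a\<in>UNIV. card (colourings_from (m + 2) w (insert_pair i a a \<sigma>)))"
  proof (rule card_UN_disjoint)
    show "\<forall>a\<in>UNIV. finite (colourings_from (m + 2) w (insert_pair i a a \<sigma>))"
      by (simp add: colourings_from_def finite_colourings)
    show "\<forall>a\<in>UNIV. \<forall>b\<in>UNIV. a \<noteq> b \<longrightarrow>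
        colourings_from (m + 2) w (insert_pair i a a \<sigma>) \<inter> colourings_from (m + 2) w (insert_pair i b b \<sigma>) = {}"
      using assms by (auto simp: colourings_from_def insert_pair_def dest!: spec[of _ i])
  qed simp
  finally show ?thesis .
qed

text \<open>The arc of the cap lies below the new level, so it only tests \<open>\<sigma>\<close>;
  the surviving strands carry their colours upwards.\<close>

lemma card_colourings_from_Cap:
  assumes "i + 2 \<le> m"
  shows "card (colourings_from m ((Cap, i) # w) \<sigma>) =
    (if \<sigma> i = \<sigma> (Suc i) then card (colourings_from (m - 2) w (remove_pair i \<sigma>)) else 0)"
proof -
  have eq: "(\<forall>x y. adjacent m [(Cap, i)] x y \<longrightarrow> (x \<in> extend_down m \<sigma> X \<longleftrightarrow> y \<in> extend_down m \<sigma> X)) \<longleftrightarrow>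
      \<sigma> i = \<sigma> (Suc i) \<and> (\<forall>p<m - 2. (0, p) \<in> X \<longleftrightarrow> remove_pair i \<sigma> p)" (is "?A \<longleftrightarrow> ?B") for X
  proof
    assume A: ?A
    have "(0, p) \<in> X \<longleftrightarrow> remove_pair i \<sigma> p" if "p < m - 2" for p
    proof (cases "p < i")
      case True
      then show ?thesis using A[rule_format, of "(0, p)" "(1, p)"] assms
        by (auto simp: adjacent_Cap remove_pair_def)
    next
      case False
      then obtain d where "p = i + d" by (metis le_iff_add not_less)
      then show ?thesis using A[rule_format, of "(0, i + 2 + d)" "(1, i + d)"] that
        by (auto simp: adjacent_Cap remove_pair_def)
    qed
    moreover have "\<sigma> i = \<sigma> (Suc i)"
      using A[rule_format, of "(0, i)" "(0, Suc i)"] assms by (auto simp: adjacent_Cap)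
    ultimately show ?B by blast
  next
    assume ?B
    then show ?A using assms by (auto simp: adjacent_Cap remove_pair_def)
  qed
  have "card (colourings_from m ((Cap, i) # w) \<sigma>) =
      card {X \<in> colourings_from (m - 2) w (remove_pair i \<sigma>). \<sigma> i = \<sigma> (Suc i)}"
    unfolding card_colourings_from_Cons eq
    unfolding colourings_from_def by (intro arg_cong[where f = card]) auto
  then show ?thesis by simp
qed

text \<open>With identity matrices both ends of every cup and cap carry the same label, so the state
  sum counts consistent labellings and a circle contributes 2. The weights 0 are placeholders, as
  counting concerns crossingless words.\<close>

interpretation colouring: tensor_model "\<lambda>a b. of_bool (a = b)" "\<lambda>a b. of_bool (a = b)" 0 0 "2 :: int"
  by standard (auto simp: UNIV_bool)

lemma colouring_ev:
  assumes "is_diagram m n w" "crossings w = 0"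
  shows "colouring.ev w (\<lambda>_. 1) \<sigma> = int (card (colourings_from m w \<sigma>))"
  using assms
proof (induction w arbitrary: m \<sigma>)
  case Nil
  have "colourings_from m [] \<sigma> = {Pair 0 ` {p. p < m \<and> \<sigma> p}}"
    by (auto simp: colourings_from_def colourings_def points_def adjacent.simps)
  then show ?case by simp
next
  case (Cons x w)
  obtain s i where x: "x = (s, i)" by (cases x)
  show ?case
  proof (cases s)
    case Cup
    then show ?thesis using Cons.prems Cons.IH[of "m + 2"]
      by (simp add: x colouring.cup_op_def card_colourings_from_Cup UNIV_bool)
  next
    case Cap
    then show ?thesis using Cons.prems Cons.IH[of "m - 2"]
      by (simp add: x colouring.cap_op_def card_colourings_from_Cap)
  next
    case (Cross b)
    then show ?thesis using Cons.prems by (simp add: x)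
  qed
qed

section \<open>Colourings as unions of components\<close>

lemma is_diagram_nth:
  assumes "is_diagram m n w" "t < length w" "w ! t = (s, i)"
  shows "i + strands_in s \<le> width m w t"
  using assms
proof (induction w arbitrary: m t)
  case (Cons x w)
  then show ?case by (cases x; cases t) auto
qed simp

lemma adjacent_points:
  assumes D: "is_diagram m n w" and "adjacent m w x y"
  shows "x \<in> points m w \<and> y \<in> points m w"
  using assms(2)
proof cases
  case (left_of_event t s i p)
  then show ?thesis using is_diagram_nth[OF D, of t s i] by (auto simp: points_def width_Suc)
next
  case (right_of_event t s i d)
  then show ?thesis using is_diagram_nth[OF D, of t s i] by (auto simp: points_def width_Suc)
next
  case (cup t i)
  then show ?thesis using is_diagram_nth[OF D, of t _ i] by (auto simp: points_def width_Suc)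
next
  case (cap t i)
  then show ?thesis using is_diagram_nth[OF D, of t _ i] by (auto simp: points_def width_Suc)
next
  case (cross_right t b i)
  then show ?thesis using is_diagram_nth[OF D, of t _ i] by (auto simp: points_def width_Suc)
next
  case (cross_left t b i)
  then show ?thesis using is_diagram_nth[OF D, of t _ i] by (auto simp: points_def width_Suc)
qed

text \<open>A colouring is the union of the components it contains, and components are nonempty and
  pairwise disjoint, so colourings correspond to sets of components.\<close>

lemma card_colourings:
  assumes "is_diagram m n w"
  shows "card (colourings m w) = 2 ^ card (components m w)"
proof -
  let ?R = "{(x, y). x \<in> points m w \<and> y \<in> points m w \<and> equivclp (adjacent m w) x y}"
  have R: "equiv (points m w) ?R"
    by (auto simp: equiv_def refl_on_def sym_def trans_def intro: equivclp_sym equivclp_trans)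
  have comp: "components m w = points m w // ?R"
    by (simp add: components_def)
  have "finite (components m w)"
    unfolding comp by (rule finite_quotient) (auto simp: finite_points)
  have "colourings m w = Union ` Pow (components m w)"
  proof (intro equalityI subsetI)
    fix X assume X: "X \<in> colourings m w"
    have "equivclp (adjacent m w) x y \<Longrightarrow> x \<in> X \<longleftrightarrow> y \<in> X" for x y
      by (induction rule: equivclp_induct) (use X in \<open>auto simp: colourings_def\<close>)
    then have "?R `` {x} \<subseteq> X" if "x \<in> X" for x
      using that by blast
    moreover have "x \<in> ?R `` {x}" if "x \<in> X" for x
      using X that by (auto simp: colourings_def)
    ultimately have "X = \<Union> ((\<lambda>x. ?R `` {x}) ` X)"
      by blast
    moreover have "(\<lambda>x. ?R `` {x}) ` X \<subseteq> components m w"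
      using X unfolding comp colourings_def by (blast intro: quotientI)
    ultimately show "X \<in> Union ` Pow (components m w)"
      by blast
  next
    fix X assume "X \<in> Union ` Pow (components m w)"
    then obtain S where S: "S \<subseteq> components m w" "X = \<Union> S"
      by auto
    have "x \<in> C \<longleftrightarrow> y \<in> C" if "adjacent m w x y" "C \<in> S" for x y C
    proof -
      have "(x, y) \<in> ?R"
        using adjacent_points[OF assms that(1)] that(1) by auto
      moreover have "C \<in> points m w // ?R" using that S by (auto simp: comp)
      ultimately show ?thesis
        using R by (metis (no_types, lifting) equiv_def in_quotient_imp_closed symD)
    qed
    then have "x \<in> X \<longleftrightarrow> y \<in> X" if "adjacent m w x y" for x y
      using that S(2) by blast
    moreover have "X \<subseteq> points m w"
      using S in_quotient_imp_subset[OF R] by (auto simp: comp)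
    ultimately show "X \<in> colourings m w"
      by (simp add: colourings_def)
  qed
  moreover have "inj_on Union (Pow (components m w))"
  proof (rule inj_onI)
    have sub: "S \<subseteq> T" if st: "S \<subseteq> components m w" "T \<subseteq> components m w" "\<Union> S = \<Union> T" for S T
    proof
      fix C assume C: "C \<in> S"
      then have "C \<noteq> {}" using st in_quotient_imp_non_empty[OF R, of C] by (auto simp: comp)
      then obtain x where x: "x \<in> C" by blast
      then obtain C' where C': "C' \<in> T" "x \<in> C'" using C st(3) by blast
      have "C = C'" using quotient_disj[OF R, of C C'] C C' x st by (auto simp: comp)
      with C' show "C \<in> T" by simp
    qed
    fix S T assume "S \<in> Pow (components m w)" "T \<in> Pow (components m w)" "\<Union> S = \<Union> T"
    then show "S = T" using sub[of S T] sub[of T S] by auto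
  qed
  ultimately have "card (colourings m w) = card (Pow (components m w))"
    by (metis card_image)
  then show ?thesis
    using \<open>finite (components m w)\<close> by (simp add: card_Pow)
qed

lemma colouring_ev_closed:
  assumes "is_diagram 0 0 w" "crossings w = 0"
  shows "colouring.ev w (\<lambda>_. 1) \<sigma> = 2 ^ closed_loops 0 w"
proof -
  have "colourings_from 0 w \<sigma> = colourings 0 w"
    by (simp add: colourings_from_def)
  \<comment> \<open>A closed diagram has no strands on its lowest and highest levels, so every
    component counts as a loop.\<close>
  moreover have "{C \<in> components 0 w. \<forall>(t, p)\<in>C. t \<noteq> 0 \<and> t \<noteq> length w} = components 0 w"
  proof -
    have "t \<noteq> 0 \<and> t \<noteq> length w" if "(t, p) \<in> points 0 w" for t p
      using that width_length[OF assms(1)] by (auto simp: points_def intro!: gr0I)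
    then show ?thesis
      by (fastforce simp: components_def quotient_def)
  qed
  ultimately show ?thesis
    using colouring_ev[OF assms] card_colourings[OF assms(1)] by (simp add: closed_loops_def)
qed

text \<open>The reduction does not follow the number of loops through isotopies. Instead it runs in
  both models at once with a common exponent \<open>l\<close>, which the colouring count then
  identifies.\<close>

lemma (in kauffman_model) ev_closed:
  assumes "w \<in> diagrams 0 0" "crossings w = 0"
  shows "ev w (\<lambda>_. 1) \<sigma> = (- (q * q) - q' * q') ^ closed_loops 0 w"
proof -
  \<comment> \<open>As a premise of the induction claim, crossinglessness makes the crossing case
    vacuous; it is passed along isotopies by \<open>crossings_isotopy\<close>.\<close>
  have "crossings w = 0 \<Longrightarrow> \<exists>l. ev w (\<lambda>_. 1) = (\<lambda>_. (- (q * q) - q' * q') ^ l) \<and>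
      colouring.ev w (\<lambda>_. 1) = (\<lambda>_. 2 ^ l)"
    using assms(1)
  proof (induction w rule: skein_induct)
    case (caps_then_cups u v)
    have "u = []"
    proof (cases u)
      case (Cons x u')
      then show ?thesis using caps_then_cups by (cases x) (auto simp: diagrams_def)
    qed
    moreover have "v = []"
    proof (cases v rule: rev_cases)
      case (snoc v' x)
      then show ?thesis using caps_then_cups by (cases x) (auto simp: diagrams_def is_diagram_append)
    qed
    ultimately show ?case
      by (auto intro!: exI[of _ 0])
  next
    case (isotopic w w')
    then show ?case
      using crossings_isotopy[OF isotopic(1)] ev_isotopy[OF isotopic(1), of 0]
        colouring.ev_isotopy[OF isotopic(1), of 0] by (simp add: shift_def)
  next
    case (loop u i v)
    then obtain l where "ev (u @ v) (\<lambda>_. 1) = (\<lambda>_. (- (q * q) - q' * q') ^ l)"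
      "colouring.ev (u @ v) (\<lambda>_. 1) = (\<lambda>_. 2 ^ l)"
      by auto
    then show ?case
      by (intro exI[of _ "Suc l"]) (simp add: ev_linear colouring.ev_linear)
  qed simp
  then obtain l where l: "ev w (\<lambda>_. 1) = (\<lambda>_. (- (q * q) - q' * q') ^ l)"
    "colouring.ev w (\<lambda>_. 1) = (\<lambda>_. 2 ^ l)"
    using assms(2) by blast
  \<comment> \<open>Powers of 2 determine their exponents; powers of the Kauffman loop value in a
    general ring might not.\<close>
  then have "(2::int) ^ l = 2 ^ closed_loops 0 w"
    using colouring_ev_closed[of w] assms by (simp add: diagrams_def)
  then show ?thesis
    using l by simp
qed

section \<open>The pairing by plat closure\<close>

context tensor_model
begin

text \<open>The closure has no endpoints; the constant function at the top and the constant
  labelling at the bottom merely turn its operator into a scalar.\<close>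

definition pairing :: "nat \<Rightarrow> nat \<Rightarrow> diagram \<Rightarrow> diagram \<Rightarrow> 'r" where
  "pairing m n w w' = ev (plat_closure m n (juxtapose n w w')) (\<lambda>_. 1) (\<lambda>_. False)"

lemma juxtapose_shift: "juxtapose n w w' = w @ shift n w'"
  by (simp add: juxtapose_def shift_def)

lemma pairing_isotopy:
  assumes "(w, w') \<in> isotopy k l"
  shows "pairing m n w x = pairing m n w' x" "pairing m n x w = pairing m n x w'"
  using ev_isotopy[OF assms, of 0] ev_isotopy[OF assms, of n]
  by (simp_all add: pairing_def plat_closure_def juxtapose_shift, simp add: shift_def)

lemma shift_smoothing:
  "shift n (smoothing_A b i) = smoothing_A b (i + n)"
  "shift n (smoothing_B b i) = smoothing_B b (i + n)"
  by (cases b; simp)+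

text \<open>Together with \<open>pairing_loop\<close> this says that the pairing satisfies the skein
  relations in each argument, so that it descends to the skein module.\<close>

lemma pairing_crossing:
  "pairing m n (u @ [(Cross b, i)] @ v) x =
     q * pairing m n (u @ smoothing_A b i @ v) x + q' * pairing m n (u @ smoothing_B b i @ v) x"
  "pairing m n x (u @ [(Cross b, i)] @ v) =
     q * pairing m n x (u @ smoothing_A b i @ v) + q' * pairing m n x (u @ smoothing_B b i @ v)"
  by (simp_all only: pairing_def plat_closure_def juxtapose_shift shift_simps ev_simps(3) ev_smoothing
        ev_linear shift_smoothing append_assoc)

lemma pairing_loop:
  "pairing m n (u @ [(Cup, i), (Cap, i)] @ v) x = \<delta> * pairing m n (u @ v) x"
  "pairing m n x (u @ [(Cup, i), (Cap, i)] @ v) = \<delta> * pairing m n x (u @ v)"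
  by (simp_all add: pairing_def plat_closure_def juxtapose_shift ev_linear)

end

lemma is_diagram_right_strands: "is_diagram m n w \<Longrightarrow> is_diagram (m + k) (n + k) w"
proof (induction w arbitrary: m)
  case (Cons x w)
  obtain s i where x: "x = (s, i)" by (cases x)
  have "m + k - strands_in s + strands_out s = m - strands_in s + strands_out s + k"
    using Cons.prems x by simp
  then have "is_diagram (m + k - strands_in s + strands_out s) (n + k) w"
    using Cons.prems Cons.IH[of "m - strands_in s + strands_out s"] by (simp only: x is_diagram.simps)
  then show ?case using Cons.prems by (simp only: x is_diagram.simps shift_simps) simp
qed simp

lemma is_diagram_shift: "is_diagram m n w \<Longrightarrow> is_diagram (m + k) (n + k) (shift k w)"
proof (induction w arbitrary: m)
  case (Cons x w)
  obtain s i where x: "x = (s, i)" by (cases x)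
  have "m + k - strands_in s + strands_out s = m - strands_in s + strands_out s + k"
    using Cons.prems x by simp
  then have "is_diagram (m + k - strands_in s + strands_out s) (n + k) (shift k w)"
    using Cons.prems Cons.IH[of "m - strands_in s + strands_out s"] by (simp only: x is_diagram.simps)
  then show ?case using Cons.prems by (simp only: x is_diagram.simps shift_simps) simp
qed simp

lemma plat_closure_diagrams:
  assumes "w \<in> diagrams m n" "w' \<in> diagrams m n"
  shows "plat_closure m n (juxtapose n w w') \<in> diagrams 0 0"
proof -
  have "is_diagram 0 (2 * m) (map (\<lambda>j. (Cup, 2 * j)) [0..<m])"
    by (induction m) (auto simp: is_diagram_append)
  \<comment> \<open>Between the two factors the left one already shows its \<open>n\<close> upper
    strands and the right one still its \<open>m\<close> lower strands; hence the shift by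
    \<open>n\<close>.\<close>
  moreover have "is_diagram (2 * m) (n + m) w" "is_diagram (n + m) (2 * n) (shift n w')"
    using is_diagram_right_strands[of m n w m] is_diagram_shift[of m n w' n] assms
    by (simp_all add: diagrams_def mult_2 add.commute)
  moreover have "is_diagram (2 * n) 0 (replicate n (Cap, 0))"
    by (induction n) auto
  ultimately show ?thesis
    unfolding plat_closure_def juxtapose_def shift_def[symmetric] diagrams_def is_diagram_append
      mem_Collect_eq by blast
qed

lemma crossings_plat_closure:
  "crossings (plat_closure m n (juxtapose n w w')) = crossings w + crossings w'"
proof -
  have "crossings (map (\<lambda>j. (Cup, 2 * j)) xs) = 0" for xs :: "nat list"
    by (induction xs) auto
  moreover have "crossings (replicate k (Cap, i)) = 0" for k i
    by (induction k) auto
  moreover have "crossings (map (\<lambda>(s, i). (s, i + n)) x) = crossings x" for x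
    by (induction x) auto
  ultimately show ?thesis
    by (simp add: plat_closure_def juxtapose_def)
qed

lemma (in kauffman_model) pairing_crossingless:
  assumes "w \<in> diagrams m n" "w' \<in> diagrams m n" "crossings w = 0" "crossings w' = 0"
  shows "pairing m n w w' = (- (q * q) - q' * q') ^ closed_loops 0 (plat_closure m n (juxtapose n w w'))"
  unfolding pairing_def
  using assms by (intro ev_closed plat_closure_diagrams) (simp_all add: crossings_plat_closure)

section \<open>The Kauffman model over Laurent polynomials\<close>

lemma qpow_mult: "qpow a * qpow b = qpow (a + b)"
  by (simp add: qpow_def mult_single)

lemma qpow_0: "qpow 0 = 1"
  by (simp add: qpow_def)

interpretation laurent: kauffman_model "qpow 1" "qpow (- 1)"
  by standard (simp add: qpow_mult qpow_0)

lemma loop_value_eq: "- (qpow 1 * qpow 1) - qpow (- 1) * qpow (- 1) = loop_value"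
  by (simp add: loop_value_def qpow_mult)

section \<open>Existence and uniqueness of the skein form\<close>

definition linear_extension :: "(diagram set \<Rightarrow> laurent) \<Rightarrow> chain \<Rightarrow> laurent" where
  "linear_extension g x = (\<Sum>C\<in>Poly_Mapping.keys x. Poly_Mapping.lookup x C * g C)"

lemma linear_extension_add:
  "linear_extension g (x + y) = linear_extension g x + linear_extension g y"
  unfolding linear_extension_def
  by (rule setsum_keys_plus_distrib[where f = "\<lambda>C a. a * g C"]) (simp_all add: algebra_simps)

lemma linear_extension_scale: "linear_extension g (scale c x) = c * linear_extension g x"
proof -
  have "linear_extension g (scale c x) =
      (\<Sum>C\<in>Poly_Mapping.keys x. Poly_Mapping.lookup (scale c x) C * g C)"
    unfolding linear_extension_def
    by (rule sum.mono_neutral_left) (auto simp: in_keys_iff lookup_scale)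
  then show ?thesis
    by (simp add: linear_extension_def lookup_scale sum_distrib_left mult.assoc)
qed

lemma linear_extension_diff:
  "linear_extension g (x - y) = linear_extension g x - linear_extension g y"
  using linear_extension_add[of g "x - y" y] by (simp only: diff_add_cancel add_diff_cancel_right')

lemma linear_extension_generator: "linear_extension g (generator m n w) = g (isotopy m n `` {w})"
  by (simp add: linear_extension_def generator_def)

lemma linear_extension_fun:
  "linear_extension (\<lambda>C. g C + h C) x = linear_extension g x + linear_extension h x"
  "linear_extension (\<lambda>C. c * g C) x = c * linear_extension g x"
  "linear_extension (\<lambda>C. 0) x = 0"
  by (simp_all add: linear_extension_def sum.distrib sum_distrib_left algebra_simps)

lemma linear_extension_span:
  assumes "x \<in> skein_span S" "\<And>r. r \<in> S \<Longrightarrow> linear_extension g r = 0"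
  shows "linear_extension g x = 0"
  using assms(1)
proof (induction rule: skein.span_induct_alt)
  case base
  then show ?case by (simp add: linear_extension_def)
next
  case (step c r y)
  then show ?case using assms(2) by (simp add: linear_extension_add linear_extension_scale)
qed

definition representative :: "diagram set \<Rightarrow> diagram" where
  "representative C = (SOME w. w \<in> C)"

lemma representative_isotopy:
  assumes "w \<in> diagrams m n"
  shows "(w, representative (isotopy m n `` {w})) \<in> isotopy m n"
proof -
  have "w \<in> isotopy m n `` {w}"
    using assms by (simp add: isotopy_def)
  then have "representative (isotopy m n `` {w}) \<in> isotopy m n `` {w}"
    unfolding representative_def by (rule someI)
  then show ?thesis by simp
qed

text \<open>Generators of the free module are isotopy classes, so representatives are chosen;
  isotopy invariance of the pairing makes the choice harmless.\<close>

definition chain_form :: "nat \<Rightarrow> nat \<Rightarrow> chain \<Rightarrow> chain \<Rightarrow> laurent" where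
  "chain_form m n x y = linear_extension (\<lambda>C. linear_extension
     (\<lambda>E. laurent.pairing m n (representative C) (representative E)) y) x"

lemma chain_form_linear:
  "chain_form m n (x + x') y = chain_form m n x y + chain_form m n x' y"
  "chain_form m n (x - x') y = chain_form m n x y - chain_form m n x' y"
  "chain_form m n (scale c x) y = c * chain_form m n x y"
  "chain_form m n x (y + y') = chain_form m n x y + chain_form m n x y'"
  "chain_form m n x (scale c y) = c * chain_form m n x y"
  by (simp_all add: chain_form_def linear_extension_add linear_extension_diff linear_extension_scale
        linear_extension_fun)

lemma chain_form_diff_right: "chain_form m n x (y - y') = chain_form m n x y - chain_form m n x y'"
  using chain_form_linear(4)[of m n x "y - y'" y'] by simp

lemma chain_form_generator:
  assumes "w \<in> diagrams m n" "w' \<in> diagrams m n"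
  shows "chain_form m n (generator m n w) (generator m n w') = laurent.pairing m n w w'"
  using laurent.pairing_isotopy[OF representative_isotopy[OF assms(1)]]
    laurent.pairing_isotopy[OF representative_isotopy[OF assms(2)]]
  by (simp add: chain_form_def linear_extension_generator)

text \<open>The universal property in use: a function on isotopy classes that obeys the skein
  relations extends linearly to a map that kills them.\<close>

lemma skein_relation_cases:
  assumes "r \<in> skein_relations m n"
    and "\<And>u b i v. u @ [(Cross b, i)] @ v \<in> diagrams m n \<Longrightarrow>
      u @ smoothing_A b i @ v \<in> diagrams m n \<Longrightarrow> u @ smoothing_B b i @ v \<in> diagrams m n \<Longrightarrow>
      f (isotopy m n `` {u @ [(Cross b, i)] @ v}) =
        qpow 1 * f (isotopy m n `` {u @ smoothing_A b i @ v})
        + qpow (- 1) * f (isotopy m n `` {u @ smoothing_B b i @ v})"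
    and "\<And>u i v. u @ [(Cup, i), (Cap, i)] @ v \<in> diagrams m n \<Longrightarrow> u @ v \<in> diagrams m n \<Longrightarrow>
      f (isotopy m n `` {u @ [(Cup, i), (Cap, i)] @ v}) = loop_value * f (isotopy m n `` {u @ v})"
  shows "linear_extension f r = 0"
  using assms(1)
proof cases
  case (crossing u b i v)
  then show ?thesis
    using assms(2)[OF crossing(2) smoothing_diagrams[OF crossing(2)]]
    by (simp only: linear_extension_diff linear_extension_add linear_extension_scale
        linear_extension_generator) simp
next
  case (loop u i v)
  have "u @ v \<in> diagrams m n"
    using loop(2) by (auto simp: diagrams_def is_diagram_append)
  then show ?thesis
    using assms(3)[OF loop(2)] loop(1)
    by (simp only: linear_extension_diff linear_extension_scale linear_extension_generator) simp
qed

lemma chain_form_span: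
  assumes "r \<in> skein_span (skein_relations m n)"
  shows "chain_form m n r y = 0" "chain_form m n x r = 0"
proof -
  note iso = laurent.pairing_isotopy[OF representative_isotopy, symmetric]
  show "chain_form m n r y = 0"
    unfolding chain_form_def
    by (rule linear_extension_span[OF assms], erule skein_relation_cases)
      (simp_all only: iso laurent.pairing_crossing laurent.pairing_loop linear_extension_fun loop_value_eq)
  \<comment> \<open>On the right the relation is killed for each class \<open>C\<close> separately,
    which leaves the outer extension of the zero function.\<close>
  have "linear_extension (\<lambda>E. laurent.pairing m n (representative C) (representative E)) r = 0" for C
    by (rule linear_extension_span[OF assms], erule skein_relation_cases)
      (simp_all only: iso laurent.pairing_crossing laurent.pairing_loop loop_value_eq)
  then show "chain_form m n x r = 0"
    by (simp add: chain_form_def linear_extension_fun)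
qed

lemma free_module_closed:
  assumes "x \<in> free_module m n" "y \<in> free_module m n"
  shows "x + y \<in> free_module m n" "scale c x \<in> free_module m n"
proof -
  show "x + y \<in> free_module m n"
    using assms keys_add[of x y] by (auto simp: free_module_def)
  have "Poly_Mapping.keys (scale c x) \<subseteq> Poly_Mapping.keys x"
    by (auto simp: in_keys_iff lookup_scale)
  then show "scale c x \<in> free_module m n"
    using assms by (auto simp: free_module_def)
qed

lemma generator_free_module: "w \<in> diagrams m n \<Longrightarrow> generator m n w \<in> free_module m n"
  by (simp add: free_module_def generator_def quotientI)

definition class_form :: "nat \<Rightarrow> nat \<Rightarrow> chain set \<Rightarrow> chain set \<Rightarrow> laurent" where
  "class_form m n X Y = chain_form m n (SOME x. x \<in> X) (SOME y. y \<in> Y)"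

lemma class_form_skein_class:
  assumes "x \<in> free_module m n" "y \<in> free_module m n"
  shows "class_form m n (skein_class m n x) (skein_class m n y) = chain_form m n x y"
proof -
  have some: "(SOME x'. x' \<in> skein_class m n x) - x \<in> skein_span (skein_relations m n)"
    if "x \<in> free_module m n" for x
  proof -
    have "x \<in> skein_class m n x"
      using that by (simp add: skein_class_def skein.span_zero)
    then have "(SOME x'. x' \<in> skein_class m n x) \<in> skein_class m n x"
      by (rule someI)
    then show ?thesis by (simp add: skein_class_def)
  qed
  show ?thesis
    using chain_form_span(1)[OF some[OF assms(1)]] chain_form_span(2)[OF some[OF assms(2)]]
    by (simp add: class_form_def chain_form_linear chain_form_diff_right)
qed

lemma flat_diagramsD:
  assumes "e \<in> flat_diagrams m n" shows "e \<in> diagrams m n" "crossings e = 0"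
  using assms by (auto simp: flat_diagrams_def crossings_eq_0_iff)

text \<open>Existence of a form, which guarantees that the choice in \<open>skein_form\<close>
  yields one.\<close>

lemma class_form_is_skein_form: "is_skein_form m n (class_form m n)"
  unfolding is_skein_form_def bilinear_on_skein_def diagram_class_def
proof (intro conjI ballI allI)
  fix e f assume "e \<in> flat_diagrams m n" "f \<in> flat_diagrams m n"
  then show "class_form m n (skein_class m n (generator m n e)) (skein_class m n (generator m n f)) =
      loop_value ^ closed_loops 0 (plat_closure m n (juxtapose n e f))"
    by (simp add: class_form_skein_class generator_free_module chain_form_generator flat_diagramsD
        laurent.pairing_crossingless loop_value_eq)
qed (simp_all add: class_form_skein_class free_module_closed chain_form_linear)

section \<open>Uniqueness of the skein form on diagram classes\<close>

lemma skein_class_eqI: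
  assumes "x - y \<in> skein_span (skein_relations m n)"
  shows "skein_class m n x = skein_class m n y"
proof -
  have "z - x \<in> skein_span (skein_relations m n) \<longleftrightarrow> z - y \<in> skein_span (skein_relations m n)" for z
    using skein.span_add[OF _ assms, of "z - x"] skein.span_diff[OF _ assms, of "z - y"] by auto
  then show ?thesis by (simp add: skein_class_def)
qed

lemma diagram_class_crossing:
  assumes "u @ [(Cross b, i)] @ v \<in> diagrams m n"
  shows "diagram_class m n (u @ [(Cross b, i)] @ v) =
    skein_class m n (scale (qpow 1) (generator m n (u @ smoothing_A b i @ v))
      + scale (qpow (- 1)) (generator m n (u @ smoothing_B b i @ v)))"
  unfolding diagram_class_def
  by (intro skein_class_eqI skein.span_base skein_relations.crossing assms)

lemma diagram_class_loop:
  assumes "u @ [(Cup, i), (Cap, i)] @ v \<in> diagrams m n"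
  shows "diagram_class m n (u @ [(Cup, i), (Cap, i)] @ v) =
    skein_class m n (scale loop_value (generator m n (u @ v)))"
  unfolding diagram_class_def
  by (intro skein_class_eqI skein.span_base skein_relations.loop assms)

lemma diagram_class_isotopy:
  assumes "(w, w') \<in> isotopy m n"
  shows "diagram_class m n w = diagram_class m n w'" "w \<in> diagrams m n" "w' \<in> diagrams m n"
proof -
  have w: "w \<in> diagrams m n" "equivclp (locally_related isotopy_move m n) w w'"
    using assms by (simp_all add: isotopy_def)
  from this(2,1) have w': "w' \<in> diagrams m n"
    by (induction rule: equivclp_induct) (auto simp: locally_related_def)
  have "isotopy m n `` {w} = isotopy m n `` {w'}"
    using w w' by (auto simp: isotopy_def intro: equivclp_trans equivclp_sym)
  then show "diagram_class m n w = diagram_class m n w'"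
    by (simp add: diagram_class_def generator_def)
  show "w \<in> diagrams m n" "w' \<in> diagrams m n"
    by fact+
qed

lemma caps_then_cups_flat:
  assumes "u @ v \<in> diagrams m n" "fst ` set u \<subseteq> {Cap}" "fst ` set v \<subseteq> {Cup}"
  shows "u @ v \<in> flat_diagrams m n"
  using assms closed_loops_caps_then_cups[OF assms(2,3), of m]
  by (fastforce simp: flat_diagrams_def)

text \<open>The form and the pairing obey the same skein relations in each argument and agree on
  flat diagrams. Reducing first the right and then the left argument to caps followed by cups
  carries the agreement to all diagrams.\<close>

lemma skein_form_eq_pairing:
  assumes form: "is_skein_form m n \<beta>" and "w \<in> diagrams m n" "w' \<in> diagrams m n"
  shows "\<beta> (diagram_class m n w) (diagram_class m n w') = laurent.pairing m n w w'"
proof -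
  note free = free_module_closed generator_free_module
  have add: "\<beta> (skein_class m n (scale c x + scale d y)) (diagram_class m n z) =
      c * \<beta> (skein_class m n x) (diagram_class m n z)
      + d * \<beta> (skein_class m n y) (diagram_class m n z)"
    "\<beta> (diagram_class m n z) (skein_class m n (scale c x + scale d y)) =
      c * \<beta> (diagram_class m n z) (skein_class m n x)
      + d * \<beta> (diagram_class m n z) (skein_class m n y)"
    if "x \<in> free_module m n" "y \<in> free_module m n" "z \<in> diagrams m n" for c d x y z
    using form that by (simp_all add: is_skein_form_def bilinear_on_skein_def diagram_class_def free)
  have scale: "\<beta> (skein_class m n (scale c x)) (diagram_class m n z) =
      c * \<beta> (skein_class m n x) (diagram_class m n z)"
    "\<beta> (diagram_class m n z) (skein_class m n (scale c x)) =
      c * \<beta> (diagram_class m n z) (skein_class m n x)"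
    if "x \<in> free_module m n" "z \<in> diagrams m n" for c x z
    using form that by (simp_all add: is_skein_form_def bilinear_on_skein_def diagram_class_def free)
  \<comment> \<open>The left argument stays flat while the right one is reduced; the outer induction
    on \<open>w\<close> then ends in this case.\<close>
  have flat: "\<beta> (diagram_class m n e) (diagram_class m n w') = laurent.pairing m n e w'"
    if e: "e \<in> flat_diagrams m n" for e
    using assms(3)
  proof (induction w' rule: skein_induct)
    case (caps_then_cups u v)
    then show ?case
      using form e caps_then_cups_flat[of u v m n] flat_diagramsD[of "u @ v"] flat_diagramsD[OF e]
      by (simp add: is_skein_form_def laurent.pairing_crossingless loop_value_eq)
  next
    case (isotopic x x')
    then show ?case using diagram_class_isotopy[OF isotopic(1)] laurent.pairing_isotopy[OF isotopic(1)]
      by simp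
  next
    case (crossing u b i v)
    then show ?case
      by (simp only: diagram_class_crossing add flat_diagramsD[OF e] generator_free_module
          laurent.pairing_crossing flip: diagram_class_def)
  next
    case (loop u i v)
    then show ?case
      by (simp only: diagram_class_loop scale flat_diagramsD[OF e] generator_free_module
          laurent.pairing_loop loop_value_eq flip: diagram_class_def)
  qed
  from assms(2) show ?thesis
  proof (induction w rule: skein_induct)
    case (caps_then_cups u v)
    then show ?case using flat caps_then_cups_flat by simp
  next
    case (isotopic x x')
    then show ?case using diagram_class_isotopy[OF isotopic(1)] laurent.pairing_isotopy[OF isotopic(1)]
      by simp
  next
    case (crossing u b i v)
    then show ?case
      by (simp only: diagram_class_crossing add assms(3) generator_free_module
          laurent.pairing_crossing flip: diagram_class_def)
  next
    case (loop u i v)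
    then show ?case
      by (simp only: diagram_class_loop scale assms(3) generator_free_module
          laurent.pairing_loop loop_value_eq flip: diagram_class_def)
  qed
qed

lemma mirror_diagrams: "w \<in> diagrams m n \<Longrightarrow> mirror w \<in> diagrams m n"
proof -
  have "is_diagram m n w \<Longrightarrow> is_diagram m n (mirror w)"
    by (induction w arbitrary: m) auto
  then show "w \<in> diagrams m n \<Longrightarrow> mirror w \<in> diagrams m n"
    by (simp add: diagrams_def)
qed

lemma P_eq_pairing:
  assumes "w \<in> diagrams m n"
  shows "P m n w = laurent.pairing m n w (mirror w)"
proof -
  have "is_skein_form m n (skein_form m n)"
    unfolding skein_form_def by (rule someI[of "is_skein_form m n", OF class_form_is_skein_form])
  then show ?thesis
    unfolding P_def using assms by (intro skein_form_eq_pairing mirror_diagrams)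
qed

section \<open>Evaluation at roots of unity\<close>

lemma laurent_eval_add: "laurent_eval (p + r) z = laurent_eval p z + laurent_eval r z"
  unfolding laurent_eval_def
  by (rule setsum_keys_plus_distrib[where f = "\<lambda>j a. of_int a * z powi j"]) (simp_all add: algebra_simps)

lemma laurent_eval_single: "laurent_eval (Poly_Mapping.single j c) z = of_int c * z powi j"
  by (simp add: laurent_eval_def)

text \<open>Bilinearity reduces the claim to two monomials, where it is the exponent law for integer
  powers of a nonzero number.\<close>

lemma laurent_eval_mult:
  assumes "z \<noteq> 0"
  shows "laurent_eval (p * r) z = laurent_eval p z * laurent_eval r z"
proof -
  have decompose: "\<exists>p' j c. p = p' + Poly_Mapping.single j c \<and>
      card (Poly_Mapping.keys p') < card (Poly_Mapping.keys p)"
    if nonzero: "p \<noteq> 0" for p :: laurent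
  proof -
    obtain j where j: "j \<in> Poly_Mapping.keys p"
      using nonzero by (metis all_not_in_conv keys_eq_empty)
    define p' where "p' = p - Poly_Mapping.single j (Poly_Mapping.lookup p j)"
    have "Poly_Mapping.keys p' = Poly_Mapping.keys p - {j}"
      by (auto simp: p'_def in_keys_iff lookup_minus lookup_single when_def split: if_splits)
    then have "card (Poly_Mapping.keys p') < card (Poly_Mapping.keys p)"
      using j by (simp only: card_Diff1_less finite_keys)
    moreover have "p = p' + Poly_Mapping.single j (Poly_Mapping.lookup p j)"
      by (simp add: p'_def)
    ultimately show ?thesis by blast
  qed
  have 0: "laurent_eval 0 z = 0" by (simp add: laurent_eval_def)
  \<comment> \<open>The left factor is first kept a monomial while terms are split off
    \<open>r\<close>; a second induction splits the left factor itself.\<close>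
  have monomial: "laurent_eval (Poly_Mapping.single j c * r) z =
      of_int c * z powi j * laurent_eval r z" for j c r
  proof (induction "card (Poly_Mapping.keys r)" arbitrary: r rule: less_induct)
    case less
    show ?case
    proof (cases "r = 0")
      case False
      then obtain r' i d where "r = r' + Poly_Mapping.single i d"
        "card (Poly_Mapping.keys r') < card (Poly_Mapping.keys r)"
        using decompose by blast
      then show ?thesis
        using less[of r'] assms
        by (simp add: distrib_left laurent_eval_add laurent_eval_single mult_single power_int_add)
    qed (simp add: 0)
  qed
  show ?thesis
  proof (induction "card (Poly_Mapping.keys p)" arbitrary: p rule: less_induct)
    case less
    show ?case
    proof (cases "p = 0")
      case False
      then obtain p' i d where "p = p' + Poly_Mapping.single i d"
        "card (Poly_Mapping.keys p') < card (Poly_Mapping.keys p)"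
        using decompose by blast
      then show ?thesis
        using less[of p'] by (simp add: distrib_right laurent_eval_add laurent_eval_single monomial)
    qed (simp add: 0)
  qed
qed

text \<open>State sums are polynomial in the matrix entries and weights, so a ring homomorphism
  carries one Kauffman model to another. Evaluation at a complex number can thus precede the
  moves.\<close>

locale kauffman_hom = kauffman_model q q' for q q' :: "'r::comm_ring_1" +
  fixes h :: "'r \<Rightarrow> 's::comm_ring_1"
  assumes h_add: "h (x + y) = h x + h y"
    and h_mult: "h (x * y) = h x * h y"
    and h_1: "h 1 = 1"
begin

sublocale image: kauffman_model "h q" "h q'"
  by standard (simp add: inverse h_1 flip: h_mult)

lemma h_0: "h 0 = 0"
  using h_add[of 0 0] by simp

lemma h_minus: "h (- x) = - h x"
  using h_add[of x "- x"] by (simp add: h_0 eq_neg_iff_add_eq_0 add.commute)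

lemma h_cup: "h (cup a b) = image.cup a b"
  by (cases a; cases b) (simp_all add: h_0 h_1 h_minus h_mult)

lemma h_cap: "h (cap a b) = image.cap a b"
  by (cases a; cases b) (simp_all add: h_0 h_1 h_minus h_mult)

lemma h_cup_op: "h (cup_op i \<phi> s) = image.cup_op i (\<lambda>s. h (\<phi> s)) s"
  by (simp add: cup_op_def image.cup_op_def UNIV_bool h_add h_mult h_cup del: cup.simps image.cup.simps)

lemma h_cap_op: "h (cap_op i \<phi> s) = image.cap_op i (\<lambda>s. h (\<phi> s)) s"
  by (simp add: cap_op_def image.cap_op_def h_mult h_cap)

lemma h_act: "h (act x \<phi> s) = image.act x (\<lambda>s. h (\<phi> s)) s"
proof -
  have "h (weight b) = image.weight b" for b
    by (cases b) simp_all
  then show ?thesis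
    by (cases x rule: act.cases) (simp_all add: h_add h_mult h_cup_op h_cap_op)
qed

lemma h_ev: "h (ev w \<phi> s) = image.ev w (\<lambda>s. h (\<phi> s)) s"
  by (induction w arbitrary: s) (simp_all add: h_act)

lemma h_pairing: "h (pairing m n w w') = image.pairing m n w w'"
  by (simp add: pairing_def image.pairing_def h_ev h_1)

end

section \<open>Behaviour of the pairing under the moves\<close>

context kauffman_model
begin

text \<open>Mirroring exchanges the weights \<open>q\<close> and \<open>q'\<close>, so the scalar of
  the mirrored move is the inverse one. The shift places the mirrored word in the right factor of
  the juxtaposition.\<close>

lemma move_factor:
  assumes root: "q ^ 8 - q ^ 4 + 1 = 0"
    and "sup isotopy_move (sup reidemeister_move three_move) a b"
  obtains c c' where "c * c' = 1" "\<And>\<phi>. ev a \<phi> = (\<lambda>s. c * ev b \<phi> s)"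
    "\<And>\<phi>. ev (shift k (mirror a)) \<phi> = (\<lambda>s. c' * ev (shift k (mirror b)) \<phi> s)"
proof -
  consider "isotopy_move a b" | "reidemeister_move a b" | "three_move a b"
    using assms(2) by auto
  then show ?thesis
  proof cases
    case 1
    show ?thesis
      by (rule that[of 1 1])
        (simp_all only: mult_1 ev_isotopy_move[OF 1]
          ev_isotopy_move[OF isotopy_move_shift[OF isotopy_move_mirror[OF 1]]])
  next
    case 2
    then show ?thesis
    proof cases
      case (R1_left i b')
      show ?thesis
        by (rule that[of "twist b'" "twist (\<not> b')"], rule twist_mult)
          (simp_all only: R1_left mirror_simps mirror_event.simps shift_simps add_Suc
            Suc_eq_plus1[symmetric] ev_R1)
    next
      case (R1_right i b')
      show ?thesis
        by (rule that[of "twist b'" "twist (\<not> b')"], rule twist_mult)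
          (simp_all only: R1_right mirror_simps mirror_event.simps shift_simps add_Suc
            Suc_eq_plus1[symmetric] ev_R1)
    next
      case (R2 b' i)
      show ?thesis
        by (rule that[of 1 1])
          (simp_all only: R2 mirror_simps mirror_event.simps shift_simps ev_R2 mult_1)
    next
      case (R3 a' b' c' i)
      \<comment> \<open>Switching all three crossings keeps the pattern noncyclic.\<close>
      have "(\<not> a') = (\<not> b') \<or> (\<not> b') = (\<not> c')" using R3 by blast
      then show ?thesis
        by (intro that[of 1 1])
          (simp_all only: R3(1,2) mirror_simps mirror_event.simps shift_simps add_Suc
            Suc_eq_plus1[symmetric] ev_R3[OF R3(3)] ev_R3 mult_1)
    qed
  next
    case 3
    then obtain b' i where ab: "a = []" "b = [(Cross b', i), (Cross b', i), (Cross b', i)]"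
      by cases auto
    have w: "weight (\<not> b) ^ 3 * weight b ^ 3 = 1" for b
      by (metis weight_mult mult.commute power_mult_distrib power_one)
    have cancel: "weight (\<not> b') ^ 3 * (weight b' ^ 3 * x) = x"
      "weight b' ^ 3 * (weight (\<not> b') ^ 3 * x) = x" for x
      using w[of b'] w[of "\<not> b'"] by (simp_all only: mult.assoc[symmetric] not_not mult_1)
    show ?thesis
      \<comment> \<open>In \<open>three_move\<close> the empty word is on the left, so the factor is
        the inverse of the one in \<open>ev_three_move\<close>.\<close>
      by (rule that[of "weight (\<not> b') ^ 3" "weight b' ^ 3"], rule w)
        (simp_all only: ab mirror_simps mirror_event.simps shift_simps
          ev_three_move[OF root] cancel ev_simps(1))
  qed
qed

text \<open>A move occurs once in the diagram and once in its mirror image, so the pairing is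
  multiplied by \<open>c * c'\<close>, which is 1.\<close>

lemma pairing_mirror_invariant:
  assumes root: "q ^ 8 - q ^ 4 + 1 = 0" and "three_move_equivalent m n w w'"
  shows "pairing k l w (mirror w) = pairing k l w' (mirror w')"
proof -
  have step: "pairing k l x (mirror x) = pairing k l y (mirror y)"
    if rel: "locally_related (sup isotopy_move (sup reidemeister_move three_move)) m n x y" for x y
  proof -
    obtain u v a b where move: "sup isotopy_move (sup reidemeister_move three_move) a b"
      and xy: "x = u @ a @ v" "y = u @ b @ v"
      using rel unfolding locally_related_def by blast
    obtain c c' where cc: "c * c' = 1" and factor: "\<And>\<phi>. ev a \<phi> = (\<lambda>s. c * ev b \<phi> s)"
      "\<And>\<phi>. ev (shift l (mirror a)) \<phi> = (\<lambda>s. c' * ev (shift l (mirror b)) \<phi> s)"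
      using move_factor[OF root move, of l] by metis
    have "pairing k l x (mirror x) = c * c' * pairing k l y (mirror y)"
      by (simp add: xy pairing_def plat_closure_def juxtapose_shift ev_linear factor mult.assoc
          mult.left_commute)
    then show ?thesis using cc by simp
  qed
  have "equivclp (locally_related (sup isotopy_move (sup reidemeister_move three_move)) m n) w w'"
    using assms(2) by (simp add: three_move_equivalent_def)
  then show ?thesis
    by (induction rule: equivclp_induct) (auto dest: step)
qed

end

text \<open>The fourth power of the root is \<open>w ^ k\<close> for the primitive sixth root of
  unity \<open>w\<close>. As \<open>k\<close> is 1 or 5 modulo 6, \<open>w ^ k\<close> is again
  primitive and thus a root of x^2 - x + 1.\<close>

lemma root_of_unity_24:
  assumes "k \<in> {1, 5, 7, 11, 13, 17, 19, 23}"
  shows "exp (of_nat k * of_real pi * \<i> / 12) ^ 8 - exp (of_nat k * of_real pi * \<i> / 12) ^ 4 + 1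
    = (0 :: complex)"
proof -
  define w where "w = cis (pi / 3)"
  have "w ^ 2 = w - 1"
    by (simp add: w_def complex_eq_iff cos_60 sin_60 power2_eq_square field_simps)
  then have w3: "w ^ 3 = - 1"
    by algebra
  have pow: "exp (of_nat k * of_real pi * \<i> / 12) ^ 4 = w ^ k"
    by (simp add: w_def cis_conv_exp flip: exp_of_nat_mult) (simp add: field_simps)
  then have pow8: "exp (of_nat k * of_real pi * \<i> / 12) ^ 8 = (w ^ k) ^ 2"
    by (simp flip: pow add: power_mult[symmetric])
  have "w ^ 6 = (w ^ 3) ^ 2"
    by (simp flip: power_mult)
  then have "w ^ 6 = 1"
    by (simp add: w3)
  then have mod: "w ^ k = w ^ (k mod 6)"
    by (metis mult_1 mult_div_mod_eq power_add power_mult power_one)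
  have "k mod 6 = 1 \<or> k mod 6 = 5"
    using assms by auto
  \<comment> \<open>This is the inverse of \<open>w\<close>, the other root of x^2 - x + 1.\<close>
  moreover have "w ^ 5 = 1 - w"
    using \<open>w ^ 2 = w - 1\<close> w3 by algebra
  ultimately have "w ^ k = w \<or> w ^ k = 1 - w"
    using mod by auto
  moreover have "w ^ 2 - w + 1 = 0" "(1 - w) ^ 2 - (1 - w) + 1 = 0"
    using \<open>w ^ 2 = w - 1\<close> by algebra+
  ultimately have "(w ^ k) ^ 2 - w ^ k + 1 = 0"
    by metis
  then show ?thesis
    by (simp only: pow pow8)
qed

theorem theorem7:
  fixes m n k :: nat and D D' :: diagram
  assumes "even (m + n)"
    and "k \<in> {1, 5, 7, 11, 13, 17, 19, 23}"
    and "D \<in> diagrams m n" and "D' \<in> diagrams m n"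
    and "three_move_equivalent m n D D'"
  shows "laurent_eval (P m n D) (exp (of_nat k * of_real pi * \<i> / 12))
       = laurent_eval (P m n D') (exp (of_nat k * of_real pi * \<i> / 12))"
proof -
  define z :: complex where "z = exp (of_nat k * of_real pi * \<i> / 12)"
  have "z \<noteq> 0" by (simp add: z_def)
  \<comment> \<open>Flipping \<open>single_one\<close> presents 1 as a monomial, to which
    \<open>laurent_eval_single\<close> applies.\<close>
  interpret eval: kauffman_hom "qpow 1" "qpow (- 1)" "\<lambda>p. laurent_eval p z"
    by standard (simp_all add: laurent_eval_add laurent_eval_mult[OF \<open>z \<noteq> 0\<close>] laurent_eval_single
        flip: single_one)
  have "laurent_eval (qpow 1) z = z"
    by (simp add: qpow_def laurent_eval_single)
  then have "laurent_eval (qpow 1) z ^ 8 - laurent_eval (qpow 1) z ^ 4 + 1 = 0"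
    using root_of_unity_24[OF assms(2)] by (simp add: z_def)
  then show ?thesis
    \<comment> \<open>Invariance is applied in the image model over the complex numbers, because the
      cyclotomic relation holds only after evaluation.\<close>
    using eval.image.pairing_mirror_invariant[OF _ assms(5)] assms(3,4)
    by (simp add: P_eq_pairing eval.h_pairing flip: z_def)
qed

end
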